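(* Let $X=(X,d_X)$ and $Y=(Y,d_Y)$ be non-degenerate bounded metric spaces, let $k>0$, and let $\mathrm{P}$ denote either one of $\mathrm{Pc}$, $\mathrm{Pp}$ (the same choice for $X$ and $Y$). The following are equivalent: (1) $X$ and $Y$ are isometric; (2) there exists an isometry $T:\overline{\mathrm{LPM}}_k(X,d_X)\to \overline{\mathrm{LPM}}_k(Y,d_Y)$ with $T(\mathrm{LPM}_k(X,d_X))=\mathrm{LPM}_k(Y,d_Y)$ and $T(\mathrm{P}(X)\cap \mathrm{LPM}_k(X,d_X))=\mathrm{P}(Y)\cap \mathrm{LPM}_k(Y,d_Y)$; (3) there exists an isometry $T:\mathrm{LPM}_k(X,d_X)\to \mathrm{LPM}_k(Y,d_Y)$ with $T(\mathrm{P}(X)\cap \mathrm{LPM}_k(X,d_X))=\mathrm{P}(Y)\cap \mathrm{LPM}_k(Y,d_Y)$. In this case, for each isometry $T:\overline{\mathrm{LPM}}_k(X,d_X)\to \overline{\mathrm{LPM}}_k(Y,d_Y)$ with $T(\mathrm{LPM}_k(X,d_X))=\mathrm{LPM}_k(Y,d_Y)$ and $T(\mathrm{P}(X)\cap \mathrm{LPM}_k(X,d_X))=\mathrm{P}(Y)\cap \mathrm{LPM}_k(Y,d_Y)$, there is an isometry $\phi:Y\to X$ such that for any $d\in \overline{\mathrm{LPM}}_k(X,d_X)$ and for any $x,y\in Y$, $$T(d)(x,y)=d(\phi(x),\phi(y)).$$ Except for the case where the cardinality of $X$ or $Y$ is equal to $2$, the isometry $\phi$ can be chosen uniquely.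
   Context: Non-degenerate means having at least two points. "Isometry" always means surjective isometry. For a metric space $Z=(Z,d_Z)$, $\mathrm{PM}(Z)$ is the set of bounded continuous pseudometrics on $Z$, viewed as functions on $Z^2$, with the sup-norm $\|\cdot\|$; all sets of pseudometrics below carry the metric induced by $\|\cdot\|$. $\mathrm{Pc}(Z)$ is the set of $d\in\mathrm{PM}(Z)$ for which there are a doubleton $\{z,w\}\subset Z$ and a compact subset $K\subset Z$ such that $d(z,w)=\|d\|$ and, whenever $d(x,y)=\|d\|$, then $x,y\in K$. $\mathrm{Pp}(Z)$ is the set of $d\in\mathrm{PM}(Z)$ for which there is exactly one (unordered) $\{z,w\}\subset Z$ with $d(z,w)=\|d\|$. $\mathrm{LPM}(Z,d_Z)$ is the set of bounded pseudometrics $d$ on $Z$ whose lipschitz constant $\operatorname{lip}(d)=\sup_{x\neq y}\frac{d(x,y)}{d_Z(x,y)}$ is finite. For $k>0$, $\mathrm{LPM}_k(Z,d_Z)=\{d\in\mathrm{LPM}(Z,d_Z)\mid \operatorname{lip}(d)<k\}$ and $\overline{\mathrm{LPM}}_k(Z,d_Z)=\{d\in\mathrm{LPM}(Z,d_Z)\mid \operatorname{lip}(d)\le k\}$. *)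

theory Defs
  imports "HOL-Analysis.Analysis"
begin

definition pseudometric :: "('a \<times> 'a \<Rightarrow> real) \<Rightarrow> bool" where
  "pseudometric d \<longleftrightarrow>
     (\<forall>x y. 0 \<le> d (x, y)) \<and> (\<forall>x. d (x, x) = 0) \<and> (\<forall>x y. d (x, y) = d (y, x)) \<and>
     (\<forall>x y z. d (x, z) \<le> d (x, y) + d (y, z))"

text \<open>A metric space is a type of class \<^class>\<open>metric_space\<close>. Bounded continuous functions on
  its square form the library type of bounded continuous functions, whose \<^const>\<open>norm\<close>
  and \<^const>\<open>dist\<close> are the sup-norm and the metric it induces.\<close>

definition PM :: "(('a::metric_space \<times> 'a) \<Rightarrow>\<^sub>C real) set" where
  "PM = {d. pseudometric (apply_bcontfun d)}"

definition Pc :: "(('a::metric_space \<times> 'a) \<Rightarrow>\<^sub>C real) set" where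
  "Pc = {d \<in> PM. \<exists>z w K. z \<noteq> w \<and> compact K \<and> apply_bcontfun d (z, w) = norm d \<and>
           (\<forall>x y. apply_bcontfun d (x, y) = norm d \<longrightarrow> x \<in> K \<and> y \<in> K)}"

text \<open>The unordered pair below may have equal entries. Requiring distinct entries would change
  the set only for the zero pseudometric, and only on spaces with at most two points.\<close>

definition Pp :: "(('a::metric_space \<times> 'a) \<Rightarrow>\<^sub>C real) set" where
  "Pp = {d \<in> PM. \<exists>!A. \<exists>z w. A = {z, w} \<and> apply_bcontfun d (z, w) = norm d}"

text \<open>The supremum is taken in the extended reals, so that an infinite Lipschitz constant is
  represented as such.\<close>

definition lip :: "('a::metric_space \<times> 'a \<Rightarrow> real) \<Rightarrow> ereal" where
  "lip d = (SUP (x, y) \<in> {(x, y). x \<noteq> y}. ereal (d (x, y) / dist x y))"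

text \<open>A pseudometric with finite Lipschitz constant is continuous, so taking \<open>LPM\<close> inside the
  bounded continuous functions loses nothing; see \<open>bounded_lip_in_bcontfun\<close> and
  \<open>LPM_image\<close>.\<close>

definition LPM :: "(('a::metric_space \<times> 'a) \<Rightarrow>\<^sub>C real) set" where
  "LPM = {d. pseudometric (apply_bcontfun d) \<and> lip (apply_bcontfun d) < \<infinity>}"

definition LPM_less :: "real \<Rightarrow> (('a::metric_space \<times> 'a) \<Rightarrow>\<^sub>C real) set" where
  "LPM_less k = {d \<in> LPM. lip (apply_bcontfun d) < ereal k}"

definition LPM_le :: "real \<Rightarrow> (('a::metric_space \<times> 'a) \<Rightarrow>\<^sub>C real) set" where
  "LPM_le k = {d \<in> LPM. lip (apply_bcontfun d) \<le> ereal k}"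

text \<open>Isometries are surjective. Only the values of \<open>f\<close> on \<open>A\<close> matter.\<close>

definition isometry_betw ::
  "'a::metric_space set \<Rightarrow> 'b::metric_space set \<Rightarrow> ('a \<Rightarrow> 'b) \<Rightarrow> bool" where
  "isometry_betw A B f \<longleftrightarrow> f ` A = B \<and> (\<forall>x\<in>A. \<forall>y\<in>A. dist (f x) (f y) = dist x y)"

lemma bounded_lip_in_bcontfun:
  fixes d :: "'a::metric_space \<times> 'a \<Rightarrow> real"
  assumes pm: "pseudometric d" and bd: "bounded (range d)" and fin: "lip d < \<infinity>"
  shows "d \<in> bcontfun"
proof -
  obtain L where L: "lip d \<le> ereal L"
    using fin by (cases "lip d") auto
  define M where "M = max L 0"
  have M: "d (x, y) \<le> M * dist x y" for x y
  proof (cases "x = y")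
    case True
    then show ?thesis using pm by (simp add: pseudometric_def)
  next
    case False
    have "ereal (d (x, y) / dist x y) \<le> lip d"
      unfolding lip_def by (rule SUP_upper2[of "(x, y)"]) (use False in auto)
    then have "d (x, y) / dist x y \<le> L"
      using L by (meson ereal_less_eq(3) order_trans)
    then have "d (x, y) / dist x y \<le> M" by (simp add: M_def)
    then show ?thesis using False by (simp add: field_simps)
  qed
  have tri: "d (x, z) \<le> d (x, y) + d (y, z)" and sym: "d (x, y) = d (y, x)" for x y z
    using pm unfolding pseudometric_def by blast+
  have diff: "\<bar>d (x, y) - d (u, v)\<bar> \<le> M * dist x u + M * dist y v" for x y u v
    using tri[of x y u] tri[of u y v] tri[of u v x] tri[of x v y]
      M[of x u] M[of y v] sym[of x u] sym[of y v] by linarith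
  have "continuous_on UNIV d"
    unfolding continuous_on_def
  proof
    fix p :: "'a \<times> 'a"
    have "((\<lambda>q. M * dist (fst q) (fst p) + M * dist (snd q) (snd p)) \<longlongrightarrow>
            M * dist (fst p) (fst p) + M * dist (snd p) (snd p)) (at p)"
      by (intro tendsto_intros)
    then have "((\<lambda>q. M * dist (fst q) (fst p) + M * dist (snd q) (snd p)) \<longlongrightarrow> 0) (at p)"
      by simp
    moreover have "norm (d q - d p) \<le> M * dist (fst q) (fst p) + M * dist (snd q) (snd p)" for q
      using diff[of "fst q" "snd q" "fst p" "snd p"] by simp
    ultimately have "((\<lambda>q. d q - d p) \<longlongrightarrow> 0) (at p)"
      by (metis (no_types, lifting) Lim_null_comparison always_eventually)
    then show "(d \<longlongrightarrow> d p) (at p)"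
      by (simp add: LIM_zero_iff)
  qed
  then show ?thesis using bd by (simp add: bcontfun_def)
qed

lemma LPM_image:
  "apply_bcontfun ` (LPM :: (('a::metric_space \<times> 'a) \<Rightarrow>\<^sub>C real) set) =
     {d. pseudometric d \<and> bounded (range d) \<and> lip d < \<infinity>}"
proof (intro equalityI subsetI)
  fix d :: "'a \<times> 'a \<Rightarrow> real"
  assume "d \<in> {d. pseudometric d \<and> bounded (range d) \<and> lip d < \<infinity>}"
  then have d: "d \<in> bcontfun" "pseudometric d" "lip d < \<infinity>"
    using bounded_lip_in_bcontfun by blast+
  then have "Bcontfun d \<in> LPM"
    by (simp add: LPM_def Bcontfun_inverse)
  then show "d \<in> apply_bcontfun ` LPM"
    using d(1) by (metis Bcontfun_inverse imageI)
next
  fix d :: "'a \<times> 'a \<Rightarrow> real"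
  assume "d \<in> apply_bcontfun ` LPM"
  then show "d \<in> {d. pseudometric d \<and> bounded (range d) \<and> lip d < \<infinity>}"
    using bounded_apply_bcontfun by (fastforce simp: LPM_def)
qed

end

theory Submission
  imports Defs
begin

text \<open>Zero is the only element of \<open>LPM_less k\<close> that is not a nontrivial metric midpoint, so an
  isometry \<open>T\<close> of these spaces fixes it and preserves norms. For \<open>z \<noteq> w\<close> there is one pseudometric
  \<open>h\<close>, attaining its norm only at \<open>{z, w}\<close>, that has distance at most \<open>norm h - e (z, w)\<close> from every
  small \<open>e\<close>. The image of \<open>h\<close> attains its norm at some \<open>{y, y'}\<close>, whence
  \<open>e (z, w) \<le> T e (y, y')\<close>; the same argument for the inverse of \<open>T\<close> gives equality for \<open>e\<close> of
  small norm. The bound on the norm is then raised in steps whose size depends only on the two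
  pairs, by comparing \<open>e\<close> with its perturbations near \<open>{z, w}\<close>. The resulting bijection of pairs
  respects the triangle inequality, hence comes from a bijection of points, which is isometric
  because \<open>T\<close> preserves the Lipschitz bound.\<close>

section \<open>Lipschitz pseudometrics\<close>

lemma pseudometricD:
  assumes "pseudometric d"
  shows "0 \<le> d (x, y)" "d (x, x) = 0" "d (x, y) = d (y, x)" "d (x, z) \<le> d (x, y) + d (y, z)"
  using assms unfolding pseudometric_def by blast+

lemma pseudometric_abs_diff: "pseudometric (\<lambda>(x, y). \<bar>g x - g y\<bar>)"
  by (auto simp: pseudometric_def)

lemma pseudometric_add:
  assumes "pseudometric d" "pseudometric e"
  shows "pseudometric (\<lambda>p. d p + e p)"
  using assms unfolding pseudometric_def
  by (smt (verit, ccfv_SIG))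

lemma pseudometric_max:
  assumes "pseudometric d" "pseudometric e"
  shows "pseudometric (\<lambda>p. max (d p) (e p))"
  using assms unfolding pseudometric_def
  by (smt (verit, ccfv_SIG))

lemma pseudometric_min_const:
  assumes "pseudometric d" "0 \<le> t"
  shows "pseudometric (\<lambda>p. min (d p) t)"
  using assms unfolding pseudometric_def
  by (smt (verit, ccfv_SIG))

lemma pseudometric_scale:
  assumes "pseudometric d" "0 \<le> t"
  shows "pseudometric (\<lambda>p. t * d p)"
  using assms unfolding pseudometric_def
  by (metis distrib_left mult_left_mono mult_nonneg_nonneg mult_zero_right)

lemma pseudometric_dist: "pseudometric (\<lambda>(x, y). dist x y)"
  by (auto simp: pseudometric_def dist_commute dist_triangle)

text \<open>Gluing a segment of length \<open>a\<close> between \<open>z\<close> and \<open>w\<close> to the pseudometric space.\<close>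

lemma pseudometric_shortcut:
  assumes d: "pseudometric d" and a: "0 \<le> a"
  shows "pseudometric (\<lambda>(x, y). min (d (x, y))
           (min (d (x, z) + a + d (w, y)) (d (x, w) + a + d (z, y))))" (is "pseudometric ?f")
proof -
  note D = pseudometricD[OF d]
  have "?f (x, v) \<le> ?f (x, u) + ?f (u, v)" for x u v
    using D(4)[of x v u] D(4)[of x z u] D(4)[of x w u] D(4)[of w v u] D(4)[of z v u]
      D(4)[of x v z] D(4)[of x v w] D(1)[of w u] D(1)[of z u] D(3)[of w u] D(3)[of z u] a
    unfolding prod.case by linarith
  moreover have "?f (x, y) = ?f (y, x)" for x y
    using D(3)[of x y] D(3)[of x z] D(3)[of x w] D(3)[of y z] D(3)[of y w] by (auto simp: min_def)
  moreover have "0 \<le> ?f (x, y)" "?f (x, x) = 0" for x y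
    using D(1)[of x y] D(1)[of x z] D(1)[of w y] D(1)[of x w] D(1)[of z y]
      D(1)[of w x] D(1)[of z x] D(2)[of x] a by simp_all
  ultimately show ?thesis
    unfolding pseudometric_def by blast
qed

section \<open>Lipschitz bounds, norms and distances as pointwise inequalities\<close>

lemma LPM_le_iff:
  "d \<in> LPM_le m \<longleftrightarrow>
     pseudometric (apply_bcontfun d) \<and> (\<forall>x y. apply_bcontfun d (x, y) \<le> m * dist x y)"
proof -
  have "(\<forall>x y. x \<noteq> y \<longrightarrow> apply_bcontfun d (x, y) / dist x y \<le> m) \<longleftrightarrow>
      (\<forall>x y. apply_bcontfun d (x, y) \<le> m * dist x y)" if "pseudometric (apply_bcontfun d)"
    using pseudometricD(2)[OF that]
    by (metis dist_eq_0_iff dist_pos_lt mult_zero_right order_refl pos_divide_le_eq)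
  moreover have "lip (apply_bcontfun d) \<le> ereal m \<longleftrightarrow>
      (\<forall>x y. x \<noteq> y \<longrightarrow> apply_bcontfun d (x, y) / dist x y \<le> m)"
    by (auto simp: lip_def SUP_le_iff)
  moreover have "lip (apply_bcontfun d) \<le> ereal m \<Longrightarrow> lip (apply_bcontfun d) < \<infinity>"
    using le_less_trans by fastforce
  ultimately show ?thesis
    unfolding LPM_le_def LPM_def mem_Collect_eq by metis
qed

lemma LPM_le_mono: "m \<le> m' \<Longrightarrow> d \<in> LPM_le m \<Longrightarrow> d \<in> LPM_le m'"
  by (meson LPM_le_iff mult_right_mono order_trans zero_le_dist)

text \<open>A strict bound on \<open>lip\<close> leaves room for a real number below
  \<open>k\<close>, and raising it to at least \<open>k / 2\<close> makes it positive. Constructions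
  can thus work with a fixed bound \<open>m\<close> and pointwise inequalities.\<close>

lemma LPM_less_iff:
  assumes "0 < k"
  shows "d \<in> LPM_less k \<longleftrightarrow> (\<exists>m. 0 < m \<and> m < k \<and> d \<in> LPM_le m)"
proof
  assume d: "d \<in> LPM_less k"
  then obtain m where m: "lip (apply_bcontfun d) < ereal m" "m < k"
    using ereal_dense2[of "lip (apply_bcontfun d)" "ereal k"] by (auto simp: LPM_less_def)
  then have "d \<in> LPM_le m"
    using d by (auto simp: LPM_less_def LPM_le_def)
  then have "d \<in> LPM_le (max m (k / 2))"
    by (rule LPM_le_mono[rotated]) simp
  then show "\<exists>m. 0 < m \<and> m < k \<and> d \<in> LPM_le m"
    using m assms by (intro exI[of _ "max m (k / 2)"]) auto
next
  assume "\<exists>m. 0 < m \<and> m < k \<and> d \<in> LPM_le m"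
  then obtain m where "m < k" "d \<in> LPM_le m" by blast
  then show "d \<in> LPM_less k"
    unfolding LPM_less_def LPM_le_def using le_less_trans ereal_less by fastforce
qed

lemma LPM_leD:
  assumes "d \<in> LPM_le m"
  shows "0 \<le> apply_bcontfun d (x, y)" "apply_bcontfun d (x, x) = 0"
    "apply_bcontfun d (x, y) = apply_bcontfun d (y, x)"
    "apply_bcontfun d (x, z) \<le> apply_bcontfun d (x, y) + apply_bcontfun d (y, z)"
    "apply_bcontfun d (x, y) \<le> m * dist x y"
    "pseudometric (apply_bcontfun d)"
proof -
  have pm: "pseudometric (apply_bcontfun d)" and le: "apply_bcontfun d (x, y) \<le> m * dist x y"
    using assms by (auto simp: LPM_le_iff)
  note D = pseudometricD[OF pm]
  show "0 \<le> apply_bcontfun d (x, y)" "apply_bcontfun d (x, x) = 0"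
    "apply_bcontfun d (x, y) = apply_bcontfun d (y, x)"
    "apply_bcontfun d (x, z) \<le> apply_bcontfun d (x, y) + apply_bcontfun d (y, z)"
    "apply_bcontfun d (x, y) \<le> m * dist x y"
    "pseudometric (apply_bcontfun d)"
    by (fact D(1) D(2) D(3) D(4) le pm)+
qed

lemma LPM_less_subset: "LPM_less k \<subseteq> LPM_le k"
  by (auto simp: LPM_less_def LPM_le_def)

lemma apply_le_norm: "apply_bcontfun (d :: 'a::topological_space \<Rightarrow>\<^sub>C real) p \<le> norm d"
  using norm_bounded[of d p] by simp

lemma norm_pseudometric_le:
  assumes "pseudometric (apply_bcontfun d)" "\<And>x y. apply_bcontfun d (x, y) \<le> b"
  shows "norm d \<le> b"
  using assms pseudometricD(1)[OF assms(1)] by (intro norm_bound) auto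

lemma dist_pair_le:
  fixes d e :: "('a::metric_space \<times> 'a) \<Rightarrow>\<^sub>C real"
  assumes "\<And>x y. apply_bcontfun d (x, y) \<le> apply_bcontfun e (x, y) + b"
    "\<And>x y. apply_bcontfun e (x, y) \<le> apply_bcontfun d (x, y) + b"
  shows "dist d e \<le> b"
proof (rule dist_bound)
  fix p :: "'a \<times> 'a"
  show "dist (apply_bcontfun d p) (apply_bcontfun e p) \<le> b"
    using assms[of "fst p" "snd p"] by (simp add: dist_real_def abs_le_iff)
qed

lemma apply_le_dist:
  fixes d e :: "'a::topological_space \<Rightarrow>\<^sub>C real"
  shows "apply_bcontfun d p \<le> apply_bcontfun e p + dist d e"
  using dist_bounded[of d p e] by (simp add: dist_real_def)

text \<open>With \<open>B\<close> bounding all distances, \<open>m * B\<close> bounds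
  \<open>f\<close>, and a finite Lipschitz constant gives continuity. Pseudometrics given by a
  formula enter the function space through this lemma.\<close>

lemma LPM_le_witness:
  fixes f :: "'a::metric_space \<times> 'a \<Rightarrow> real"
  assumes bd: "bounded (UNIV :: 'a set)" and m: "0 \<le> m"
    and pm: "pseudometric f" and le: "\<And>x y. f (x, y) \<le> m * dist x y"
  obtains d where "d \<in> LPM_le m" "apply_bcontfun d = f"
proof -
  obtain B where B: "\<And>x y :: 'a. dist x y \<le> B"
    using bd by (auto simp: bounded_two_points)
  have "\<bar>f (x, y)\<bar> \<le> m * B" for x y
    using le[of x y] pseudometricD(1)[OF pm, of x y] mult_left_mono[OF B m, of x y] by linarith
  then have "bounded (range f)"
    by (intro boundedI[of _ "m * B"]) auto
  moreover have "f (x, y) / dist x y \<le> m" if "x \<noteq> y" for x y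
    using le[of x y] that by (simp add: pos_divide_le_eq)
  then have "lip f \<le> ereal m"
    unfolding lip_def by (intro SUP_least) auto
  then have "lip f < \<infinity>"
    using le_less_trans by fastforce
  ultimately have "f \<in> bcontfun"
    using bounded_lip_in_bcontfun pm by blast
  then have "apply_bcontfun (Bcontfun f) = f"
    by (simp add: Bcontfun_inverse)
  then show ?thesis
    using that[of "Bcontfun f"] pm le by (simp add: LPM_le_iff)
qed

text \<open>Both functions are nonnegative, so at each pair of points they differ by at most the
  larger of the two values.\<close>

lemma dist_le_max_norm:
  assumes "d \<in> LPM_less k" "e \<in> LPM_less k"
  shows "dist d e \<le> max (norm d) (norm e)"
proof (rule dist_pair_le)
  have d: "pseudometric (apply_bcontfun d)" and e: "pseudometric (apply_bcontfun e)"
    using assms by (auto simp: LPM_less_def LPM_def)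
  fix x y
  show "apply_bcontfun d (x, y) \<le> apply_bcontfun e (x, y) + max (norm d) (norm e)"
    using apply_le_norm[of d "(x, y)"] pseudometricD(1)[OF e, of x y] by linarith
  show "apply_bcontfun e (x, y) \<le> apply_bcontfun d (x, y) + max (norm d) (norm e)"
    using apply_le_norm[of e "(x, y)"] pseudometricD(1)[OF d, of x y] by linarith
qed

lemma scaleR_LPM_le:
  assumes "d \<in> LPM_le m" "0 \<le> a"
  shows "a *\<^sub>R d \<in> LPM_le (a * m)"
proof -
  have "pseudometric (\<lambda>p. a * apply_bcontfun d p)"
    using pseudometric_scale LPM_leD(6) assms by blast
  moreover have "a * apply_bcontfun d (x, y) \<le> a * m * dist x y" for x y
    using mult_left_mono[OF LPM_leD(5)[OF assms(1)] assms(2)] by (simp add: mult.assoc)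
  ultimately show ?thesis
    by (simp add: LPM_le_iff scaleR_bcontfun.rep_eq)
qed

lemma zero_in_LPM_le: "0 \<le> m \<Longrightarrow> 0 \<in> LPM_le m"
  by (simp add: LPM_le_iff pseudometric_def zero_bcontfun.rep_eq)

text \<open>The witness is a multiple of
  \<open>\<bar>u z x - u z y\<bar> + \<bar>u w x - u w y\<bar>\<close>, where \<open>u v\<close> is
  a cone of height \<open>r = dist z w\<close> at \<open>v\<close>. A summand equals
  \<open>r\<close> only if one of its points is the apex, so both do only at the pair
  \<open>{z, w}\<close>.\<close>

lemma ex_unique_peak:
  fixes z w :: "'a::metric_space"
  assumes bd: "bounded (UNIV :: 'a set)" and zw: "z \<noteq> w" and m: "0 < m" and b: "0 < b"
  obtains p where "p \<in> LPM_le m" "norm p \<le> b" "0 < norm p" "apply_bcontfun p (z, w) = norm p"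
    "\<And>x y. apply_bcontfun p (x, y) = norm p \<Longrightarrow> {x, y} = {z, w}"
proof -
  define r where "r = dist z w"
  define u where "u v x = max 0 (r - dist x v)" for v x :: 'a
  \<comment> \<open>Each cone is 1-Lipschitz, so the multiple has Lipschitz constant at most
    \<open>2 * a\<close>; its maximum is \<open>2 * a * r\<close>. The two entries keep these below
    \<open>m\<close> and \<open>b\<close>.\<close>
  define a where "a = min (m / 2) (b / (2 * r))"
  have r: "0 < r" using zw by (simp add: r_def)
  have a: "0 < a" "2 * a \<le> m" "a * (2 * r) \<le> b"
    using m b r by (auto simp: a_def min_def field_simps)
  have u0: "0 \<le> u v x" "u v x \<le> r" for v x
    using r by (auto simp: u_def)
  have uv: "\<bar>u v x - u v y\<bar> \<le> r" for v x y
    using u0[of v x] u0[of v y] by linarith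
  have u_max: "x = v \<or> y = v" if "\<bar>u v x - u v y\<bar> = r" for v x y
  proof (rule ccontr)
    assume "\<not> (x = v \<or> y = v)"
    then have "u v x < r" "u v y < r" using r by (auto simp: u_def)
    then show False using that u0[of v x] u0[of v y] by linarith
  qed
  have ul: "\<bar>u v x - u v y\<bar> \<le> dist x y" for v x y
    using dist_triangle[of x v y] dist_triangle[of y v x] by (auto simp: u_def dist_commute)
  define f where "f = (\<lambda>p. a * ((\<lambda>(x, y). \<bar>u z x - u z y\<bar>) p + (\<lambda>(x, y). \<bar>u w x - u w y\<bar>) p))"
  have f: "f (x, y) = a * (\<bar>u z x - u z y\<bar> + \<bar>u w x - u w y\<bar>)" for x y
    by (simp add: f_def)
  have "pseudometric f"
    unfolding f_def using a by (intro pseudometric_scale pseudometric_add pseudometric_abs_diff) simp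
  moreover have "f (x, y) \<le> m * dist x y" for x y
  proof -
    have "f (x, y) \<le> a * (2 * dist x y)"
      unfolding f using ul[of z x y] ul[of w x y] a by (intro mult_left_mono) auto
    also have "\<dots> \<le> m * dist x y"
      using mult_right_mono[OF a(2), of "dist x y"] by (simp add: ac_simps)
    finally show ?thesis .
  qed
  ultimately obtain p where p: "p \<in> LPM_le m" "apply_bcontfun p = f"
    using LPM_le_witness[OF bd, of m f] m by auto
  have le: "f (x, y) \<le> a * (2 * r)" for x y
    unfolding f using uv[of z x y] uv[of w x y] a by (intro mult_left_mono) auto
  have eq: "f (z, w) = a * (2 * r)"
    using r by (auto simp: f u_def r_def dist_commute)
  have norm: "norm p = a * (2 * r)"
    using norm_pseudometric_le[of p "a * (2 * r)"] le eq p apply_le_norm[of p "(z, w)"] LPM_leD(6)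
    by (metis order_antisym)
  show ?thesis
  proof (rule that)
    fix x y assume "apply_bcontfun p (x, y) = norm p"
    then have "\<bar>u z x - u z y\<bar> + \<bar>u w x - u w y\<bar> = 2 * r"
      using a p norm f by simp
    then have "\<bar>u z x - u z y\<bar> = r" "\<bar>u w x - u w y\<bar> = r"
      using uv[of z x y] uv[of w x y] by linarith+
    then have "x = z \<or> y = z" "x = w \<or> y = w"
      using u_max by blast+
    then show "{x, y} = {z, w}" using zw by auto
  qed (use p norm eq a r in auto)
qed

section \<open>Peaks and the classes \<open>Pp\<close> and \<open>Pc\<close>\<close>

lemma PpE:
  assumes "d \<in> Pp"
  obtains z w where "d \<in> PM" "apply_bcontfun d (z, w) = norm d"
    "\<And>x y. apply_bcontfun d (x, y) = norm d \<Longrightarrow> {x, y} = {z, w}"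
proof -
  have "\<exists>!A. \<exists>z w. A = {z, w} \<and> apply_bcontfun d (z, w) = norm d"
    using assms by (simp add: Pp_def)
  then obtain A where A: "\<exists>z w. A = {z, w} \<and> apply_bcontfun d (z, w) = norm d"
    "\<forall>B. (\<exists>z w. B = {z, w} \<and> apply_bcontfun d (z, w) = norm d) \<longrightarrow> B = A"
    by (rule ex1E)
  obtain z w where zw: "A = {z, w}" "apply_bcontfun d (z, w) = norm d"
    using A(1) by (elim exE conjE)
  show ?thesis
  proof (rule that)
    show "d \<in> PM" using assms by (simp add: Pp_def)
    show "apply_bcontfun d (z, w) = norm d" by (fact zw)
    fix x y assume "apply_bcontfun d (x, y) = norm d"
    then show "{x, y} = {z, w}"
      unfolding zw(1)[symmetric] by (intro A(2)[rule_format] exI[of _ x] exI[of _ y] conjI refl)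
  qed
qed

lemma PpI:
  assumes "d \<in> PM" "apply_bcontfun d (z, w) = norm d"
    "\<And>x y. apply_bcontfun d (x, y) = norm d \<Longrightarrow> {x, y} = {z, w}"
  shows "d \<in> Pp"
proof -
  have "\<exists>!A. \<exists>z w. A = {z, w} \<and> apply_bcontfun d (z, w) = norm d"
  proof (rule ex1I[of _ "{z, w}"])
    show "\<exists>z' w'. {z, w} = {z', w'} \<and> apply_bcontfun d (z', w') = norm d"
      using assms(2) by (intro exI[of _ z] exI[of _ w] conjI refl)
    fix A assume "\<exists>z w. A = {z, w} \<and> apply_bcontfun d (z, w) = norm d"
    then obtain x y where "A = {x, y}" "apply_bcontfun d (x, y) = norm d" by (elim exE conjE)
    then show "A = {z, w}" using assms(3)[of x y] by simp
  qed
  then show ?thesis using assms(1) by (simp add: Pp_def)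
qed

text \<open>The two points of the peak form a compact set, and they differ since a pseudometric
  vanishes on the diagonal. Test pseudometrics with a unique peak therefore serve both choices of
  the class.\<close>

lemma Pp_subset_Pc:
  assumes "d \<in> Pp" "d \<noteq> 0"
  shows "d \<in> Pc"
proof -
  obtain z w where zw: "d \<in> PM" "apply_bcontfun d (z, w) = norm d"
    "\<And>x y. apply_bcontfun d (x, y) = norm d \<Longrightarrow> {x, y} = {z, w}"
    using PpE[OF assms(1)] by metis
  then have "z \<noteq> w"
    using assms(2) pseudometricD(2)[of "apply_bcontfun d" z] by (auto simp: PM_def)
  moreover have "x \<in> {z, w} \<and> y \<in> {z, w}" if "apply_bcontfun d (x, y) = norm d" for x y
    using zw(3)[OF that] by blast
  moreover have "compact {z, w}" by simp
  ultimately show ?thesis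
    unfolding Pc_def using zw(1,2) by blast
qed

section \<open>From isometries to pairs of points\<close>

text \<open>The inverse \<open>S\<close> is a parameter, so that by \<open>swap\<close> each result
  about \<open>T\<close> also holds with the two spaces exchanged. Of the condition on the peak
  classes only attainment of norms is kept, which both choices of the class provide.\<close>

locale peak_isometry =
  fixes k :: real
    and T :: "(('a::metric_space \<times> 'a) \<Rightarrow>\<^sub>C real) \<Rightarrow> (('b::metric_space \<times> 'b) \<Rightarrow>\<^sub>C real)"
    and S :: "(('b \<times> 'b) \<Rightarrow>\<^sub>C real) \<Rightarrow> (('a \<times> 'a) \<Rightarrow>\<^sub>C real)"
  assumes k_pos: "0 < k"
    and bounded_dom: "bounded (UNIV :: 'a set)"
    and bounded_cod: "bounded (UNIV :: 'b set)"
    and T_mem: "d \<in> LPM_less k \<Longrightarrow> T d \<in> LPM_less k"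
    and S_mem: "e \<in> LPM_less k \<Longrightarrow> S e \<in> LPM_less k"
    and ST: "d \<in> LPM_less k \<Longrightarrow> S (T d) = d"
    and TS: "e \<in> LPM_less k \<Longrightarrow> T (S e) = e"
    and dist_T: "d \<in> LPM_less k \<Longrightarrow> d' \<in> LPM_less k \<Longrightarrow> dist (T d) (T d') = dist d d'"
    and attain_T: "d \<in> LPM_less k \<Longrightarrow> d \<in> Pp \<Longrightarrow> d \<noteq> 0 \<Longrightarrow>
      \<exists>y y'. apply_bcontfun (T d) (y, y') = norm (T d)"
    and attain_S: "e \<in> LPM_less k \<Longrightarrow> e \<in> Pp \<Longrightarrow> e \<noteq> 0 \<Longrightarrow>
      \<exists>z w. apply_bcontfun (S e) (z, w) = norm (S e)"
begin

lemma swap: "peak_isometry k S T"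
proof
  fix e e' :: "('b \<times> 'b) \<Rightarrow>\<^sub>C real"
  assume "e \<in> LPM_less k" "e' \<in> LPM_less k"
  then show "dist (S e) (S e') = dist e e'"
    using dist_T[of "S e" "S e'"] S_mem TS by simp
qed (use k_pos bounded_dom bounded_cod T_mem S_mem ST TS attain_T attain_S in auto)

lemma LPM_le_less: "d \<in> LPM_le m \<Longrightarrow> m < k \<Longrightarrow> 0 < m \<Longrightarrow> d \<in> LPM_less k"
  using LPM_less_iff[OF k_pos] by blast

lemma zero_in_LPM_less: "(0 :: ('c::metric_space \<times> 'c) \<Rightarrow>\<^sub>C real) \<in> LPM_less k"
proof -
  have "(0 :: ('c \<times> 'c) \<Rightarrow>\<^sub>C real) \<in> LPM_le (k / 2)"
    by (rule zero_in_LPM_le) (use k_pos in simp)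
  then show ?thesis
    unfolding LPM_less_iff[OF k_pos] using k_pos by (intro exI[of _ "k / 2"]) simp
qed

lemma LPM_less_bound:
  assumes "d \<in> LPM_less k" "m0 < k"
  obtains m where "d \<in> LPM_le m" "m0 \<le> m" "0 < m" "m < k"
proof -
  obtain m where "0 < m" "m < k" "d \<in> LPM_le m"
    using assms LPM_less_iff[OF k_pos] by blast
  then show ?thesis
    using that[of "max m m0"] assms LPM_le_mono[of m "max m m0" d] by simp
qed

text \<open>The zero pseudometric is the only point of \<open>LPM_less k\<close> that is not the midpoint of two
  other points, because distances never exceed the larger of the two norms.\<close>

lemma T_zero: "T 0 = 0"
proof (rule ccontr)
  define q where "q = T 0"
  assume "T 0 \<noteq> 0"
  then have q: "q \<in> LPM_less k" "0 < norm q"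
    by (auto simp: q_def zero_in_LPM_less T_mem)
  then obtain m where m: "q \<in> LPM_le m" "0 < m" "m < k"
    using LPM_less_iff[OF k_pos] by blast
  \<comment> \<open>Chosen so that \<open>(1 + \<epsilon>) * m < k\<close>: both
    \<open>(1 + \<epsilon>) *\<^sub>R q\<close> and \<open>(1 - \<epsilon>) *\<^sub>R q\<close> lie
    in \<open>LPM_less k\<close>, with midpoint \<open>q\<close>.\<close>
  define \<epsilon> where "\<epsilon> = min (1 / 2) (k / m - 1) / 2"
  have \<epsilon>: "0 < \<epsilon>" "\<epsilon> < 1" "(1 + \<epsilon>) * m < k"
    using m by (auto simp: \<epsilon>_def min_def field_simps)
  have mem: "a *\<^sub>R q \<in> LPM_less k" if "0 < a" "a \<le> 1 + \<epsilon>" for a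
  proof (rule LPM_le_less)
    show "a *\<^sub>R q \<in> LPM_le (a * m)" by (rule scaleR_LPM_le) (use m that in auto)
    show "a * m < k" using that \<epsilon> m mult_right_mono[of a "1 + \<epsilon>" m] by linarith
  qed (use that m in simp)
  have d: "dist (a *\<^sub>R q) (b *\<^sub>R q) = \<bar>a - b\<bar> * norm q" for a b
    by (metis dist_norm norm_scaleR scaleR_left_diff_distrib)
  have S0: "S q = 0" by (simp add: q_def ST zero_in_LPM_less)
  interpret S: peak_isometry k S T by (rule swap)
  have n: "norm (S (a *\<^sub>R q)) = \<bar>a - 1\<bar> * norm q" if "0 < a" "a \<le> 1 + \<epsilon>" for a
    using S.dist_T[OF mem[OF that] q(1)] d[of a 1] S0 by simp
  \<comment> \<open>Since \<open>S q = 0\<close>, both images have norm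
    \<open>\<epsilon> * norm q\<close>, yet their distance is twice that.\<close>
  have "2 * \<epsilon> * norm q = dist (S ((1 + \<epsilon>) *\<^sub>R q)) (S ((1 - \<epsilon>) *\<^sub>R q))"
    using S.dist_T[OF mem mem, of "1 + \<epsilon>" "1 - \<epsilon>"] d \<epsilon> by simp
  also have "\<dots> \<le> max (norm (S ((1 + \<epsilon>) *\<^sub>R q))) (norm (S ((1 - \<epsilon>) *\<^sub>R q)))"
    by (rule dist_le_max_norm[of _ k]) (use S_mem mem \<epsilon> in simp_all)
  also have "\<dots> = \<epsilon> * norm q"
    using n \<epsilon> by simp
  finally show False using \<epsilon> q by simp
qed

lemma norm_T: "d \<in> LPM_less k \<Longrightarrow> norm (T d) = norm d"
  using dist_T[OF _ zero_in_LPM_less, of d] T_zero by simp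

end

text \<open>An \<open>m\<close>-Lipschitz pseudometric is at most \<open>m * dist z w\<close> at
  \<open>(z, w)\<close>. Bounding norms by half of this makes any two values of admissible
  pseudometrics add up to at most \<open>m * dist z w\<close>.\<close>

definition dominates ::
  "((('a::metric_space \<times> 'a) \<Rightarrow>\<^sub>C real) \<Rightarrow> (('b::metric_space \<times> 'b) \<Rightarrow>\<^sub>C real)) \<Rightarrow>
    real \<Rightarrow> 'a \<Rightarrow> 'a \<Rightarrow> 'b \<Rightarrow> 'b \<Rightarrow> bool" where
  "dominates T m z w y y' \<longleftrightarrow>
     (\<forall>e\<in>LPM_le m. norm e \<le> m * dist z w / 2 \<longrightarrow>
        apply_bcontfun e (z, w) \<le> apply_bcontfun (T e) (y, y'))"

lemma dominates_mono:
  assumes "dominates T m' z w y y'" "m \<le> m'"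
  shows "dominates T m z w y y'"
  unfolding dominates_def
proof (intro ballI impI)
  fix e :: "('a \<times> 'a) \<Rightarrow>\<^sub>C real"
  assume e: "e \<in> LPM_le m" "norm e \<le> m * dist z w / 2"
  have "m * dist z w \<le> m' * dist z w"
    using assms(2) by (simp add: mult_right_mono)
  then have "norm e \<le> m' * dist z w / 2" using e by linarith
  then show "apply_bcontfun e (z, w) \<le> apply_bcontfun (T e) (y, y')"
    using assms LPM_le_mono e unfolding dominates_def by blast
qed

section \<open>The pair in the second space that corresponds to a given pair\<close>

context peak_isometry
begin

text \<open>The pseudometric \<open>h\<close> built here lies within \<open>norm h - e (z, w)\<close> of every small \<open>e\<close>, so a
  pair where \<open>T h\<close> attains its norm forces \<open>T e\<close> to be at least \<open>e (z, w)\<close> there.\<close>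

lemma ex_dominated_pair:
  fixes z w :: 'a
  assumes zw: "z \<noteq> w" and m: "0 < m" "m < k"
  obtains y y' where "y \<noteq> y'" "dominates T m z w y y'"
proof -
  define s where "s = m * dist z w"
  define E :: "(('a \<times> 'a) \<Rightarrow>\<^sub>C real) set" where "E = {e \<in> LPM_le m. norm e \<le> s / 2}"
  \<comment> \<open>\<open>g\<close> is the largest function with
    \<open>g x \<le> m * dist x w\<close> and, for all \<open>e\<close> in \<open>E\<close>,
    \<open>g x \<le> e (x, w) + s - e (z, w)\<close>. These bounds give \<open>g w = 0\<close> and
    \<open>g z = s\<close>; \<open>h\<close> will be \<open>\<bar>g x - g y\<bar>\<close>.\<close>
  define g where
    "g x = Inf (insert (m * dist x w)
       ((\<lambda>e. apply_bcontfun e (x, w) + s - apply_bcontfun e (z, w)) ` E))" for x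
  have s: "0 < s" using zw m by (simp add: s_def)
  have E0: "0 \<in> E" using m s by (simp add: E_def zero_in_LPM_le)
  have E_le: "apply_bcontfun e p \<le> s / 2" if "e \<in> E" for e p
    using that apply_le_norm[of e p] by (simp add: E_def)
  have bdd: "bdd_below (insert (m * dist x w)
      ((\<lambda>e. apply_bcontfun e (x, w) + s - apply_bcontfun e (z, w)) ` E))" for x
  proof (rule bdd_belowI[of _ 0])
    fix r assume "r \<in> insert (m * dist x w)
      ((\<lambda>e. apply_bcontfun e (x, w) + s - apply_bcontfun e (z, w)) ` E)"
    then show "0 \<le> r"
    proof
      assume "r = m * dist x w" then show ?thesis using m by simp
    next
      assume "r \<in> (\<lambda>e. apply_bcontfun e (x, w) + s - apply_bcontfun e (z, w)) ` E"
      then obtain e where e: "e \<in> E" "r = apply_bcontfun e (x, w) + s - apply_bcontfun e (z, w)"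
        by blast
      then have "0 \<le> apply_bcontfun e (x, w)" using LPM_leD(1) by (auto simp: E_def)
      then show ?thesis using e E_le[OF e(1), of "(z, w)"] s by linarith
    qed
  qed
  have g_le1: "g x \<le> m * dist x w" for x
    unfolding g_def by (rule cInf_lower[OF _ bdd]) simp
  have g_le2: "g x \<le> apply_bcontfun e (x, w) + s - apply_bcontfun e (z, w)" if "e \<in> E" for x e
    unfolding g_def by (rule cInf_lower[OF _ bdd]) (use that in auto)
  have g_ge: "b \<le> g x" if "b \<le> m * dist x w"
    "\<And>e. e \<in> E \<Longrightarrow> b \<le> apply_bcontfun e (x, w) + s - apply_bcontfun e (z, w)" for b x
    unfolding g_def by (rule cInf_greatest) (use that in auto)
  \<comment> \<open>Two admissible values add up to at most \<open>s\<close>, so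
    \<open>e (y, w)\<close> lies below every bound in the infimum.\<close>
  have g_dom: "apply_bcontfun e (y, w) \<le> g y" if e: "e \<in> E" for e y
  proof (rule g_ge)
    show "apply_bcontfun e (y, w) \<le> m * dist y w"
      using e LPM_leD(5) by (auto simp: E_def)
    fix e' assume e': "e' \<in> E"
    then have "0 \<le> apply_bcontfun e' (y, w)" using LPM_leD(1) by (auto simp: E_def)
    then show "apply_bcontfun e (y, w) \<le> apply_bcontfun e' (y, w) + s - apply_bcontfun e' (z, w)"
      using E_le[OF e, of "(y, w)"] E_le[OF e', of "(z, w)"] by linarith
  qed
  have g0: "0 \<le> g x" for x
    using g_dom[OF E0, of x] by (simp add: zero_bcontfun.rep_eq)
  have gs: "g x \<le> s" for x
    using g_le2[OF E0, of x] by (simp add: zero_bcontfun.rep_eq)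
  have gw: "g w = 0"
    using g_le1[of w] g0[of w] by simp
  have gz: "g z = s"
    using gs[of z] g_ge[of s z] by (simp add: s_def)
  have g_lip: "g x - m * dist x y \<le> g y" for x y
  proof (rule g_ge)
    have "m * dist x w \<le> m * dist x y + m * dist y w"
      using mult_left_mono[OF dist_triangle[of x w y], of m] m by (simp add: distrib_left)
    then show "g x - m * dist x y \<le> m * dist y w"
      using g_le1[of x] by linarith
    fix e assume e: "e \<in> E"
    then have "e \<in> LPM_le m" by (simp add: E_def)
    then show "g x - m * dist x y \<le> apply_bcontfun e (y, w) + s - apply_bcontfun e (z, w)"
      using LPM_leD(4)[of e m x w y] LPM_leD(5)[of e m x y] g_le2[OF e, of x] by linarith
  qed
  \<comment> \<open>The bound on \<open>g x\<close> from \<open>e\<close> and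
    \<open>e (y, w) \<le> g y\<close> combine through the triangle inequality for
    \<open>e\<close>.\<close>
  have g_near: "g x - g y \<le> apply_bcontfun e (x, y) + (s - apply_bcontfun e (z, w))"
    if e: "e \<in> E" for e x y
  proof -
    have "e \<in> LPM_le m" using e by (simp add: E_def)
    then show ?thesis
      using g_le2[OF e, of x] g_dom[OF e, of y] LPM_leD(4)[of e m x w y] by linarith
  qed
  have "\<bar>g x - g y\<bar> \<le> m * dist x y" for x y
    using g_lip[of x y] g_lip[of y x] by (simp add: dist_commute)
  then obtain h where h: "h \<in> LPM_le m" "apply_bcontfun h = (\<lambda>(x, y). \<bar>g x - g y\<bar>)"
    using LPM_le_witness[OF bounded_dom _ pseudometric_abs_diff, of m g] m by auto
  have "\<bar>g x - g y\<bar> \<le> s" for x y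
    using g0[of x] g0[of y] gs[of x] gs[of y] by linarith
  then have "norm h \<le> s"
    using norm_pseudometric_le[OF LPM_leD(6)[OF h(1)], of s] h(2) by simp
  then have norm_h: "norm h = s"
    using apply_le_norm[of h "(z, w)"] gz gw h s by simp
  have near: "apply_bcontfun h (x, y) \<le> apply_bcontfun e (x, y) + (s - apply_bcontfun e (z, w))"
    if e: "e \<in> E" for e x y
  proof -
    have "e \<in> LPM_le m" using e by (simp add: E_def)
    then show ?thesis
      using g_near[OF e, of x y] g_near[OF e, of y x] LPM_leD(3)[of e m x y] h by auto
  qed
  \<comment> \<open>\<open>near\<close> bounds \<open>h\<close> from above; the other direction
    again uses \<open>e (x, y) + e (z, w) \<le> s\<close>.\<close>
  have dist_h: "dist h e \<le> s - apply_bcontfun e (z, w)" if e: "e \<in> E" for e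
  proof (rule dist_pair_le)
    fix x y
    show "apply_bcontfun e (x, y) \<le> apply_bcontfun h (x, y) + (s - apply_bcontfun e (z, w))"
      using E_le[OF e, of "(x, y)"] E_le[OF e, of "(z, w)"] LPM_leD(1)[OF h(1), of x y] by linarith
  qed (use near e in blast)
  \<comment> \<open>\<open>p\<close> belongs to \<open>E\<close>, so where \<open>h\<close> equals
    \<open>s\<close>, \<open>near\<close> makes \<open>p\<close> at least
    \<open>p (z, w) = norm p\<close>. Hence \<open>h\<close> inherits the unique peak of
    \<open>p\<close>.\<close>
  obtain p where p: "p \<in> LPM_le m" "norm p \<le> s / 2" "apply_bcontfun p (z, w) = norm p"
    "\<And>x y. apply_bcontfun p (x, y) = norm p \<Longrightarrow> {x, y} = {z, w}"
    using ex_unique_peak[OF bounded_dom zw, of m "s / 2"] m s by (metis half_gt_zero)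
  have peak: "{x, y} = {z, w}" if "apply_bcontfun h (x, y) = norm h" for x y
  proof (rule p(4))
    have "p \<in> E" using p by (simp add: E_def)
    then show "apply_bcontfun p (x, y) = norm p"
      using near[of p x y] that norm_h p apply_le_norm[of p "(x, y)"] by simp
  qed
  have hzw: "apply_bcontfun h (z, w) = norm h"
    using h gz gw norm_h s by simp
  have "h \<in> PM" using LPM_leD(6)[OF h(1)] by (simp add: PM_def)
  then have "h \<in> Pp"
    using hzw peak by (rule PpI)
  moreover have hk: "h \<in> LPM_less k" using LPM_le_less h m by blast
  moreover have "h \<noteq> 0" using norm_h s by auto
  ultimately obtain y y' where y: "apply_bcontfun (T h) (y, y') = norm (T h)"
    using attain_T by blast
  then have y_s: "apply_bcontfun (T h) (y, y') = s"
    using norm_T[OF hk] norm_h by simp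
  have "T h \<in> LPM_le k" using T_mem[OF hk] LPM_less_subset by blast
  then have "y \<noteq> y'" using LPM_leD(2) y_s s by force
  moreover have "dominates T m z w y y'"
    unfolding dominates_def
  proof (intro ballI impI)
    fix e :: "('a \<times> 'a) \<Rightarrow>\<^sub>C real"
    assume e: "e \<in> LPM_le m" "norm e \<le> m * dist z w / 2"
    then have "e \<in> E" by (simp add: E_def s_def)
    moreover have "e \<in> LPM_less k" using LPM_le_less e m by blast
    ultimately show "apply_bcontfun e (z, w) \<le> apply_bcontfun (T e) (y, y')"
      using apply_le_dist[of "T h" "(y, y')" "T e"] dist_T[OF hk] dist_h y_s by fastforce
  qed
  ultimately show ?thesis using that by blast
qed

text \<open>\<open>S\<close> dominates from \<open>(y, y')\<close> to some \<open>(z', w')\<close>.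
  A small peak \<open>p\<close> at \<open>{z, w}\<close> identifies this pair:
  \<open>norm p \<le> T p (y, y') \<le> p (z', w')\<close>, so it is \<open>{z, w}\<close>
  again.\<close>

lemma dominates_swap:
  assumes dom: "dominates T (k / 2) z w y y'" and zw: "z \<noteq> w" and yy: "y \<noteq> y'" and m: "m < k"
  shows "dominates S m y y' z w"
proof -
  have pos: "0 < k / 2" "0 < k / 4 * min (dist z w) (dist y y')"
    using k_pos zw yy by auto
  obtain p where p: "p \<in> LPM_le (k / 2)" "norm p \<le> k / 4 * min (dist z w) (dist y y')"
    "0 < norm p" "apply_bcontfun p (z, w) = norm p"
    "\<And>x y. apply_bcontfun p (x, y) = norm p \<Longrightarrow> {x, y} = {z, w}"
    using ex_unique_peak[OF bounded_dom zw pos] by metis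
  have min: "k / 4 * min (dist z w) (dist y y') \<le> k / 4 * dist z w"
    "k / 4 * min (dist z w) (dist y y') \<le> k / 4 * dist y y'"
    using k_pos by (simp_all add: mult_left_mono)
  have pk: "p \<in> LPM_less k" using LPM_le_less[OF p(1)] k_pos by simp
  \<comment> \<open>The Lipschitz constant of \<open>T p\<close> is only known to be below
    \<open>k\<close>, so \<open>m'\<close> is taken large enough to admit \<open>T p\<close>;
    \<open>m \<le> m'\<close> lets the result descend to \<open>m\<close>.\<close>
  then obtain m' where m': "T p \<in> LPM_le m'" "max m (k / 2) \<le> m'" "0 < m'" "m' < k"
    using LPM_less_bound[OF T_mem[OF pk], of "max m (k / 2)"] m k_pos by auto
  interpret S: peak_isometry k S T by (rule swap)
  obtain z' w' where z': "dominates S m' y y' z' w'"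
    using S.ex_dominated_pair[OF yy] m' by blast
  have "k / 2 * dist y y' \<le> m' * dist y y'"
    using m' by (intro mult_right_mono) auto
  then have "norm (T p) \<le> m' * dist y y' / 2"
    using p min norm_T[OF pk] by linarith
  then have "apply_bcontfun (T p) (y, y') \<le> apply_bcontfun p (z', w')"
    using z' m'(1) ST[OF pk] unfolding dominates_def by force
  moreover have "norm p \<le> apply_bcontfun (T p) (y, y')"
    using dom p min unfolding dominates_def by force
  ultimately have "apply_bcontfun p (z', w') = norm p"
    using apply_le_norm[of p "(z', w')"] by linarith
  then have "z' = z \<and> w' = w \<or> z' = w \<and> w' = z"
    using p(5)[of z' w'] by (simp add: doubleton_eq_iff)
  moreover have "apply_bcontfun (S e) (z', w') = apply_bcontfun (S e) (w', z')"
    if "e \<in> LPM_le m'" for e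
    using S_mem LPM_le_less[OF that] m' LPM_less_subset LPM_leD(3) by blast
  ultimately have "dominates S m' y y' z w"
    using z' unfolding dominates_def by auto
  then show ?thesis
    using dominates_mono m' by (metis max.bounded_iff)
qed

text \<open>Swapping twice extends domination at \<open>k / 2\<close> to every \<open>m < k\<close>,
  for \<open>T\<close> and for \<open>S\<close>. An \<open>m\<close> that bounds the Lipschitz
  constants of \<open>e\<close> and \<open>T e\<close> then gives both inequalities. Since
  \<open>m\<close> is at least \<open>k / 2\<close>, one norm threshold with factor
  \<open>k / 4\<close> suffices for all \<open>e\<close>.\<close>

lemma ex_local_pair:
  fixes z w :: 'a
  assumes zw: "z \<noteq> w"
  obtains y y' where "y \<noteq> y'"
    "\<And>e. e \<in> LPM_less k \<Longrightarrow> norm e \<le> k / 4 * min (dist z w) (dist y y') \<Longrightarrow>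
      apply_bcontfun (T e) (y, y') = apply_bcontfun e (z, w)"
proof -
  obtain y y' where y: "y \<noteq> y'" "dominates T (k / 2) z w y y'"
    using ex_dominated_pair[OF zw, of "k / 2"] k_pos by auto
  interpret S: peak_isometry k S T by (rule swap)
  have S: "dominates S m y y' z w" if "m < k" for m
    using dominates_swap y zw that by blast
  have T: "dominates T m z w y y'" if "m < k" for m
    using S.dominates_swap[OF S y(1) zw that] k_pos by simp
  show ?thesis
  proof (rule that[OF y(1)])
    fix e :: "('a \<times> 'a) \<Rightarrow>\<^sub>C real"
    assume e: "e \<in> LPM_less k" and ne: "norm e \<le> k / 4 * min (dist z w) (dist y y')"
    obtain m1 where m1: "e \<in> LPM_le m1" "k / 2 \<le> m1" "m1 < k"
      using LPM_less_bound[OF e, of "k / 2"] k_pos by auto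
    obtain m where m: "T e \<in> LPM_le m" "m1 \<le> m" "m < k"
      using LPM_less_bound[OF T_mem[OF e], of m1] m1 by auto
    have em: "e \<in> LPM_le m" using LPM_le_mono m1 m by blast
    have "k / 4 * min (dist z w) (dist y y') \<le> m / 2 * dist z w"
      by (rule mult_mono) (use k_pos m m1 in auto)
    moreover have "k / 4 * min (dist z w) (dist y y') \<le> m / 2 * dist y y'"
      by (rule mult_mono) (use k_pos m m1 in auto)
    ultimately have n: "norm e \<le> m * dist z w / 2" "norm (T e) \<le> m * dist y y' / 2"
      using ne norm_T[OF e] by auto
    have "apply_bcontfun e (z, w) \<le> apply_bcontfun (T e) (y, y')"
      using T m em n unfolding dominates_def by blast
    moreover have "apply_bcontfun (T e) (y, y') \<le> apply_bcontfun (S (T e)) (z, w)"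
      using S m n unfolding dominates_def by blast
    ultimately show "apply_bcontfun (T e) (y, y') = apply_bcontfun e (z, w)"
      using ST[OF e] by simp
  qed
qed

text \<open>For \<open>d\<close> known to transfer, \<open>dist e d \<le> \<delta>\<close> confines \<open>T e (y, y')\<close> to within \<open>\<delta>\<close> of
  \<open>d (z, w)\<close>. The upper bound comes from shrinking \<open>e (z, w)\<close> by \<open>\<delta>\<close> with a shortcut, the lower
  one from enlarging it by \<open>\<delta>\<close>; the latter keeps the Lipschitz bound only while \<open>e (z, w)\<close> is
  small.\<close>

lemma transfer_step:
  assumes Q: "\<And>f. f \<in> LPM_less k \<Longrightarrow> norm f \<le> t \<Longrightarrow>
      apply_bcontfun (T f) (y, y') = apply_bcontfun f (z, w)"
    and e: "e \<in> LPM_less k" and ne: "norm e \<le> t + \<delta>"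
    and \<delta>: "0 < \<delta>" "2 * \<delta> \<le> t" "4 * \<delta> \<le> k * dist z w"
  shows "apply_bcontfun (T e) (y, y') \<le> max \<delta> (apply_bcontfun e (z, w))"
    and "apply_bcontfun e (z, w) \<le> \<delta> \<Longrightarrow> apply_bcontfun e (z, w) \<le> apply_bcontfun (T e) (y, y')"
proof -
  obtain m where m: "e \<in> LPM_le m" "k / 2 \<le> m" "m < k" "0 < m"
    using LPM_less_bound[OF e, of "k / 2"] k_pos by auto
  note D = LPM_leD[OF m(1)]
  have e_le: "apply_bcontfun e p \<le> t + \<delta>" for p
    using apply_le_norm[of e p] ne by linarith
  have near: "\<bar>apply_bcontfun (T e) (y, y') - apply_bcontfun f (z, w)\<bar> \<le> \<delta>"
    if f: "f \<in> LPM_le m" "\<And>u v. apply_bcontfun f (u, v) \<le> t"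
      "\<And>u v. apply_bcontfun f (u, v) \<le> apply_bcontfun e (u, v) + \<delta>"
      "\<And>u v. apply_bcontfun e (u, v) \<le> apply_bcontfun f (u, v) + \<delta>" for f
  proof -
    have fk: "f \<in> LPM_less k" using LPM_le_less f m by blast
    have "norm f \<le> t" using norm_pseudometric_le LPM_leD(6) f by blast
    then have "apply_bcontfun (T f) (y, y') = apply_bcontfun f (z, w)" using Q fk by blast
    moreover have "dist (T e) (T f) \<le> \<delta>"
      using dist_T[OF e fk] dist_pair_le[of e f \<delta>] f by simp
    ultimately show ?thesis
      using apply_le_dist[of "T e" "(y, y')" "T f"] apply_le_dist[of "T f" "(y, y')" "T e"]
      by (simp add: dist_commute abs_le_iff)
  qed
  show "apply_bcontfun (T e) (y, y') \<le> max \<delta> (apply_bcontfun e (z, w))"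
  proof -
    \<comment> \<open>The target value at \<open>(z, w)\<close> is \<open>e (z, w)\<close> lowered
      by \<open>\<delta>\<close>, but not below \<open>0\<close>. A segment of this length between
      \<open>z\<close> and \<open>w\<close> reduces values by at most \<open>\<delta>\<close>, and
      the later cap at \<open>t\<close> makes \<open>Q\<close> applicable.\<close>
    define a where "a = max 0 (apply_bcontfun e (z, w) - \<delta>)"
    define f0 where "f0 = (\<lambda>(u, v). min (apply_bcontfun e (u, v))
      (min (apply_bcontfun e (u, z) + a + apply_bcontfun e (w, v))
        (apply_bcontfun e (u, w) + a + apply_bcontfun e (z, v))))"
    have a: "0 \<le> a" "a \<le> apply_bcontfun e (z, w)" "a \<le> t" "apply_bcontfun e (z, w) \<le> a + \<delta>"
      using e_le[of "(z, w)"] D(1)[of z w] \<delta> by (auto simp: a_def)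
    have "pseudometric f0"
      unfolding f0_def using pseudometric_shortcut[OF D(6) a(1)] .
    then have pm: "pseudometric (\<lambda>p. min (f0 p) t)"
      by (rule pseudometric_min_const) (use \<delta> in simp)
    have f0_le: "f0 (u, v) \<le> apply_bcontfun e (u, v)" for u v
      by (simp add: f0_def)
    have f0_ge: "apply_bcontfun e (u, v) \<le> f0 (u, v) + \<delta>" for u v
      using D(4)[of u v z] D(4)[of z v w] D(4)[of u v w] D(4)[of w v z] D(3)[of z w] a \<delta>
      unfolding f0_def prod.case by linarith
    have "min (f0 (u, v)) t \<le> m * dist u v" for u v
      using f0_le[of u v] D(5)[of u v] by linarith
    then obtain f where f: "f \<in> LPM_le m" "apply_bcontfun f = (\<lambda>p. min (f0 p) t)"
      using LPM_le_witness[OF bounded_dom _ pm] m by (metis less_imp_le)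
    have "f0 (z, w) = a"
      using a D(1)[of z w] D(2)[of z] D(2)[of w] by (auto simp: f0_def)
    then have "apply_bcontfun f (z, w) = a" using a f by simp
    moreover have "\<bar>apply_bcontfun (T e) (y, y') - apply_bcontfun f (z, w)\<bar> \<le> \<delta>"
    proof (rule near[OF f(1)])
      fix u v
      show "apply_bcontfun f (u, v) \<le> t" using f by simp
      show "apply_bcontfun f (u, v) \<le> apply_bcontfun e (u, v) + \<delta>"
        using f0_le[of u v] f \<delta> by simp
      show "apply_bcontfun e (u, v) \<le> apply_bcontfun f (u, v) + \<delta>"
        using f0_ge[of u v] f e_le[of "(u, v)"] by simp
    qed
    \<comment> \<open>Here \<open>a + \<delta>\<close> is the maximum in the claim.\<close>
    ultimately show ?thesis by (auto simp: a_def)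
  qed
  show "apply_bcontfun e (z, w) \<le> apply_bcontfun (T e) (y, y')"
    if ez: "apply_bcontfun e (z, w) \<le> \<delta>"
  proof -
    \<comment> \<open>\<open>g\<close> vanishes at \<open>w\<close> and changes from
      \<open>u\<close> to \<open>v\<close> by at most \<open>e (u, v) + \<delta>\<close> and at most
      \<open>m * dist u v\<close>. The maximum of \<open>e\<close> and
      \<open>\<bar>g u - g v\<bar>\<close> thus raises the value at \<open>(z, w)\<close> by
      \<open>\<delta>\<close> and no other value by more.\<close>
    define g where "g x = min (apply_bcontfun e (x, w) + \<delta>) (m * dist x w)" for x
    define f0 where "f0 = (\<lambda>p. max (apply_bcontfun e p) ((\<lambda>(u, v). \<bar>g u - g v\<bar>) p))"
    have f0: "f0 (u, v) = max (apply_bcontfun e (u, v)) \<bar>g u - g v\<bar>" for u v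
      by (simp add: f0_def)
    have "pseudometric f0"
      unfolding f0_def by (intro pseudometric_max D(6) pseudometric_abs_diff)
    then have pm: "pseudometric (\<lambda>p. min (f0 p) t)"
      by (rule pseudometric_min_const) (use \<delta> in simp)
    have tri: "m * dist u w \<le> m * dist u v + m * dist v w" for u v
      using mult_left_mono[OF dist_triangle[of u w v], of m] m by (simp add: distrib_left)
    have lip: "g u - g v \<le> m * dist u v" for u v
      using D(4)[of u w v] D(5)[of u v] tri[of u v] unfolding g_def by linarith
    have diff: "g u - g v \<le> apply_bcontfun e (u, v) + \<delta>" for u v
      using D(4)[of u w v] D(5)[of v w] D(1)[of u v] \<delta> unfolding g_def by linarith
    have "min (f0 (u, v)) t \<le> m * dist u v" for u v
      using lip[of u v] lip[of v u] D(5)[of u v] unfolding f0 by (simp add: dist_commute)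
    then obtain f where f: "f \<in> LPM_le m" "apply_bcontfun f = (\<lambda>p. min (f0 p) t)"
      using LPM_le_witness[OF bounded_dom _ pm] m by (metis less_imp_le)
    \<comment> \<open>Since \<open>e (z, w) + \<delta> \<le> 2 * \<delta> \<le> k / 2 * dist z
      w\<close>, the minimum in \<open>g z\<close> is its first entry. The cap does not lower this
      value, because \<open>2 * \<delta> \<le> t\<close>.\<close>
    have "k / 2 * dist z w \<le> m * dist z w"
      using m by (intro mult_right_mono) auto
    then have "g z = apply_bcontfun e (z, w) + \<delta>"
      using ez \<delta> unfolding g_def by simp
    moreover have "g w = 0" using D(2)[of w] \<delta> by (simp add: g_def)
    ultimately have "apply_bcontfun f (z, w) = apply_bcontfun e (z, w) + \<delta>"
      using f ez \<delta> D(1)[of z w] by (simp add: f0)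
    moreover have "\<bar>apply_bcontfun (T e) (y, y') - apply_bcontfun f (z, w)\<bar> \<le> \<delta>"
    proof (rule near[OF f(1)])
      fix u v
      show "apply_bcontfun f (u, v) \<le> t" using f by simp
      show "apply_bcontfun f (u, v) \<le> apply_bcontfun e (u, v) + \<delta>"
        using diff[of u v] diff[of v u] D(3)[of u v] f \<delta> by (simp add: f0 min_le_iff_disj abs_le_iff)
      show "apply_bcontfun e (u, v) \<le> apply_bcontfun f (u, v) + \<delta>"
        using f e_le[of "(u, v)"] \<delta> by (simp add: f0)
    qed
    ultimately show ?thesis by linarith
  qed
qed

text \<open>Equality for norms up to \<open>t\<close> extends to \<open>t + n * \<delta>\<close> by
  induction on \<open>n\<close>. One \<open>\<delta>\<close> serves all steps because only the two
  pairs and \<open>k\<close> determine it, so every norm is reached.\<close>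

lemma ex_pair:
  fixes z w :: 'a
  assumes zw: "z \<noteq> w"
  obtains y y' where "y \<noteq> y'"
    "\<And>e. e \<in> LPM_less k \<Longrightarrow> apply_bcontfun (T e) (y, y') = apply_bcontfun e (z, w)"
proof -
  obtain y y' where y: "y \<noteq> y'" and loc:
    "\<And>e. e \<in> LPM_less k \<Longrightarrow> norm e \<le> k / 4 * min (dist z w) (dist y y') \<Longrightarrow>
      apply_bcontfun (T e) (y, y') = apply_bcontfun e (z, w)"
    using ex_local_pair[OF zw] by blast
  define t where "t = k / 4 * min (dist z w) (dist y y')"
  \<comment> \<open>This gives \<open>2 * \<delta> \<le> t\<close>, and
    \<open>4 * \<delta> = 2 * t\<close> is at most \<open>k / 2\<close> times either distance, as
    \<open>transfer_step\<close> requires for \<open>T\<close> and for \<open>S\<close>.\<close>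
  define \<delta> where "\<delta> = t / 2"
  have t: "0 < t" "t \<le> k / 4 * dist z w" "t \<le> k / 4 * dist y y'"
    using k_pos zw y by (auto simp: t_def)
  interpret S: peak_isometry k S T by (rule swap)
  have "apply_bcontfun (T e) (y, y') = apply_bcontfun e (z, w)"
    if "e \<in> LPM_less k" "norm e \<le> t + real n * \<delta>" for e n
    using that
  proof (induction n arbitrary: e)
    case 0
    then show ?case using loc by (simp add: t_def)
  next
    case (Suc n)
    define t' where "t' = t + real n * \<delta>"
    have \<delta>: "0 < \<delta>" "2 * \<delta> \<le> t'" "4 * \<delta> \<le> k * dist z w" "4 * \<delta> \<le> k * dist y y'"
      using t by (auto simp: \<delta>_def t'_def)
    have ne: "norm e \<le> t' + \<delta>" "norm (T e) \<le> t' + \<delta>"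
      using Suc.prems norm_T by (auto simp: t'_def distrib_right)
    have Q: "apply_bcontfun (S f) (z, w) = apply_bcontfun f (y, y')"
      if "f \<in> LPM_less k" "norm f \<le> t'" for f
      using Suc.IH[of "S f"] that S_mem TS S.norm_T by (simp add: t'_def)
    have Q': "apply_bcontfun (T f) (y, y') = apply_bcontfun f (z, w)"
      if "f \<in> LPM_less k" "norm f \<le> t'" for f
      using Suc.IH that by (simp add: t'_def)
    have "apply_bcontfun (T e) (y, y') \<le> max \<delta> (apply_bcontfun e (z, w))"
      "apply_bcontfun e (z, w) \<le> \<delta> \<Longrightarrow> apply_bcontfun e (z, w) \<le> apply_bcontfun (T e) (y, y')"
      using transfer_step[OF Q' Suc.prems(1) ne(1) \<delta>(1,2,3)] by blast+
    moreover have "apply_bcontfun e (z, w) \<le> max \<delta> (apply_bcontfun (T e) (y, y'))"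
      "apply_bcontfun (T e) (y, y') \<le> \<delta> \<Longrightarrow> apply_bcontfun (T e) (y, y') \<le> apply_bcontfun e (z, w)"
      using S.transfer_step[OF Q T_mem[OF Suc.prems(1)] ne(2) \<delta>(1,2,4)] ST[OF Suc.prems(1)]
      by simp_all
    \<comment> \<open>If \<open>e (z, w) \<le> \<delta>\<close>, then
      \<open>T e (y, y') \<le> \<delta>\<close> as well and the conditional bounds give equality;
      otherwise the two bounds by maxima do.\<close>
    ultimately show ?case by linarith
  qed
  moreover have "\<exists>n. norm e \<le> t + real n * \<delta>" for e :: "('a \<times> 'a) \<Rightarrow>\<^sub>C real"
  proof -
    obtain n where "norm e < real n * \<delta>"
      using ex_less_of_nat_mult[of \<delta> "norm e"] t by (auto simp: \<delta>_def)
    then show ?thesis using t by (intro exI[of _ n]) linarith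
  qed
  ultimately show ?thesis
    using that[OF y] by blast
qed

end

section \<open>From pairs to points\<close>

text \<open>Each point lies in at least two of the three sets, so the six memberships involve at
  most three points, and three distinct pairs among three points are the sides of a
  triangle.\<close>

lemma triangle_pairs:
  assumes card: "card P = 2" "card Q = 2" "card R = 2"
    and ne: "P \<noteq> Q" "P \<noteq> R" "Q \<noteq> R"
    and sub: "P \<subseteq> Q \<union> R" "Q \<subseteq> P \<union> R" "R \<subseteq> P \<union> Q"
  obtains a b c where "P = {a, b}" "Q = {a, c}" "R = {b, c}" "a \<noteq> b" "a \<noteq> c" "b \<noteq> c"
proof -
  obtain p p' where P: "P = {p, p'}" "p \<noteq> p'" using card by (auto simp: card_2_iff)
  obtain q q' where Q: "Q = {q, q'}" "q \<noteq> q'" using card by (auto simp: card_2_iff)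
  obtain r r' where R: "R = {r, r'}" "r \<noteq> r'" using card by (auto simp: card_2_iff)
  have "\<exists>a b c. P = {a, b} \<and> Q = {a, c} \<and> R = {b, c} \<and> a \<noteq> b \<and> a \<noteq> c \<and> b \<noteq> c"
    using ne sub P(2) Q(2) R(2) unfolding P(1) Q(1) R(1) by (auto simp: doubleton_eq_iff)
  then show ?thesis using that by blast
qed

text \<open>The pairs containing \<open>y\<close> go to pairs with a common point, as otherwise three of them would
  go to a triangle.\<close>

lemma ex_point_map_of_pair_map:
  fixes \<tau> :: "'b \<Rightarrow> 'b \<Rightarrow> 'a set"
  assumes nondeg: "\<exists>y y' :: 'b. y \<noteq> y'"
    and sym: "\<And>y u. y \<noteq> u \<Longrightarrow> \<tau> y u = \<tau> u y"
    and card: "\<And>y u. y \<noteq> u \<Longrightarrow> card (\<tau> y u) = 2"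
    and inj: "\<And>y u y' u'. y \<noteq> u \<Longrightarrow> y' \<noteq> u' \<Longrightarrow> \<tau> y u = \<tau> y' u' \<Longrightarrow> {y, u} = {y', u'}"
    and tri: "\<And>y u v. y \<noteq> u \<Longrightarrow> y \<noteq> v \<Longrightarrow> u \<noteq> v \<Longrightarrow> \<tau> y u \<subseteq> \<tau> y v \<union> \<tau> u v"
  shows "\<exists>\<phi>. \<forall>y u. y \<noteq> u \<longrightarrow> \<tau> y u = {\<phi> y, \<phi> u}"
proof -
  have triangle: "\<exists>a b c. \<tau> y u = {a, b} \<and> \<tau> y v = {a, c} \<and> \<tau> u v = {b, c} \<and>
      a \<noteq> b \<and> a \<noteq> c \<and> b \<noteq> c" if d: "y \<noteq> u" "y \<noteq> v" "u \<noteq> v" for y u v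
  proof (rule triangle_pairs[OF card[OF d(1)] card[OF d(2)] card[OF d(3)]])
    show "\<tau> y u \<noteq> \<tau> y v" using inj[OF d(1,2)] d by (auto simp: doubleton_eq_iff)
    show "\<tau> y u \<noteq> \<tau> u v" using inj[OF d(1,3)] d by (auto simp: doubleton_eq_iff)
    show "\<tau> y v \<noteq> \<tau> u v" using inj[OF d(2,3)] d by (auto simp: doubleton_eq_iff)
    show "\<tau> y u \<subseteq> \<tau> y v \<union> \<tau> u v" using tri d by blast
    show "\<tau> y v \<subseteq> \<tau> y u \<union> \<tau> u v" using tri[of y v u] sym[of v u] d by blast
    show "\<tau> u v \<subseteq> \<tau> y u \<union> \<tau> y v" using tri[of u v y] sym[of u y] sym[of v y] d by blast
  qed blast
  obtain y0 y1 :: 'b where y01: "y0 \<noteq> y1" using nondeg by blast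
  show ?thesis
  proof (cases "\<exists>v. v \<noteq> y0 \<and> v \<noteq> y1")
    \<comment> \<open>Without a third point there is a single pair, and its two image points may be
      assigned in either order.\<close>
    case False
    obtain z w where "\<tau> y0 y1 = {z, w}" using card[OF y01] by (auto simp: card_2_iff)
    then have "\<tau> y u = {if y = y0 then z else w, if u = y0 then z else w}" if "y \<noteq> u" for y u
    proof -
      have "y = y0 \<and> u = y1 \<or> y = y1 \<and> u = y0" using False that by metis
      then show ?thesis using \<open>\<tau> y0 y1 = {z, w}\<close> sym[OF y01] y01 by auto
    qed
    then show ?thesis by (intro exI[of _ "\<lambda>y. if y = y0 then z else w"]) blast
  next
    case True
    then obtain y2 where y2: "y2 \<noteq> y0" "y2 \<noteq> y1" by blast
    have third: "\<exists>v. v \<noteq> y \<and> v \<noteq> u" for y u :: 'b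
    proof (rule ccontr)
      assume "\<nexists>v. v \<noteq> y \<and> v \<noteq> u"
      then have "y0 = y \<or> y0 = u" "y1 = y \<or> y1 = u" "y2 = y \<or> y2 = u" by blast+
      then show False using y01 y2 by auto
    qed
    have "\<exists>a. \<forall>u. u \<noteq> y \<longrightarrow> a \<in> \<tau> y u" for y
    proof -
      obtain u where u: "y \<noteq> u" using third[of y y] by metis
      obtain v where v: "y \<noteq> v" "u \<noteq> v" using third[of y u] by metis
      obtain a b c where abc: "\<tau> y u = {a, b}" "\<tau> y v = {a, c}" "\<tau> u v = {b, c}"
        "a \<noteq> b" "a \<noteq> c" "b \<noteq> c"
        using triangle[OF u v] by blast
      \<comment> \<open>Otherwise \<open>\<tau> y t\<close> meets \<open>{a, b}\<close> in
        \<open>b\<close> and \<open>{a, c}\<close> in \<open>c\<close>, so it equals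
        \<open>\<tau> u v\<close>, against injectivity on pairs.\<close>
      have "a \<in> \<tau> y t" if t: "t \<noteq> y" for t
      proof (rule ccontr)
        assume a: "a \<notin> \<tau> y t"
        then have tu: "t \<noteq> u" and tv: "t \<noteq> v" using abc by auto
        have "\<exists>p. p \<in> \<tau> y u \<and> p \<in> \<tau> y t"
          using triangle[of y u t] u t tu by blast
        then have b: "b \<in> \<tau> y t" using abc(1) a by auto
        have "\<exists>q. q \<in> \<tau> y v \<and> q \<in> \<tau> y t"
          using triangle[of y v t] v t tv by blast
        then have c: "c \<in> \<tau> y t" using abc(2) a by auto
        obtain p q where "\<tau> y t = {p, q}" using card[of y t] t by (auto simp: card_2_iff)
        then have "\<tau> y t = \<tau> u v" using b c abc(3,6) by auto
        then show False using inj[of y t u v] t u v by (auto simp: doubleton_eq_iff)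
      qed
      then show ?thesis by blast
    qed
    then obtain \<phi> where \<phi>: "\<And>y u. u \<noteq> y \<Longrightarrow> \<phi> y \<in> \<tau> y u" by metis
    have "\<tau> y u = {\<phi> y, \<phi> u}" if yu: "y \<noteq> u" for y u
    proof -
      obtain v where v: "y \<noteq> v" "u \<noteq> v" using third[of y u] by metis
      obtain a b c where abc: "\<tau> y u = {a, b}" "\<tau> y v = {a, c}" "\<tau> u v = {b, c}"
        "a \<noteq> b" "a \<noteq> c" "b \<noteq> c"
        using triangle[OF yu v] by blast
      have "\<phi> y \<in> {a, b}" "\<phi> y \<in> {a, c}"
        using \<phi>[of u y] \<phi>[of v y] yu v abc(1,2) by simp_all
      moreover have "\<phi> u \<in> {a, b}" "\<phi> u \<in> {b, c}"
        using \<phi>[of y u] \<phi>[of v u] sym[OF yu] yu v abc(1,3) by simp_all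
      ultimately show ?thesis using abc(1,4-6) by auto
    qed
    then show ?thesis by blast
  qed
qed

text \<open>A pseudometric that peaks only at \<open>{z, w}\<close> would attain its norm at
  \<open>(x, y)\<close> too.\<close>

lemma LPM_le_separates_pairs:
  fixes x y z w :: "'a::metric_space"
  assumes bd: "bounded (UNIV :: 'a set)" and m: "0 < m" and zw: "z \<noteq> w"
    and eq: "\<And>e. e \<in> LPM_le m \<Longrightarrow> apply_bcontfun e (x, y) = apply_bcontfun e (z, w)"
  shows "{x, y} = {z, w}"
proof -
  obtain p where "p \<in> LPM_le m" "apply_bcontfun p (z, w) = norm p"
    "\<And>x y. apply_bcontfun p (x, y) = norm p \<Longrightarrow> {x, y} = {z, w}"
    using ex_unique_peak[OF bd zw m zero_less_one] by metis
  then show ?thesis using eq by metis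
qed

text \<open>The witness comes from a cone at \<open>a\<close> that is narrow enough to vanish at
  \<open>b\<close> and on \<open>F\<close>. It serves to show that a point belongs to a given finite
  set.\<close>

lemma LPM_le_separates_point:
  fixes a b :: "'a::metric_space"
  assumes bd: "bounded (UNIV :: 'a set)" and m: "0 < m" and F: "finite F" "a \<notin> F" and ab: "a \<noteq> b"
  obtains e where "e \<in> LPM_le m" "0 < apply_bcontfun e (a, b)"
    "\<And>u v. u \<in> F \<Longrightarrow> v \<in> F \<Longrightarrow> apply_bcontfun e (u, v) = 0"
proof -
  obtain r where r: "0 < r" "\<And>x. x \<in> insert b F \<Longrightarrow> x \<noteq> a \<Longrightarrow> r \<le> dist a x"
    using finite_set_avoid[of "insert b F" a] F by blast
  define g where "g x = m * max 0 (r - dist a x)" for x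
  have g: "g a = m * r" "\<And>x. x \<in> insert b F \<Longrightarrow> g x = 0"
    using r F ab by (force simp: g_def)+
  have "\<bar>g x - g y\<bar> \<le> m * dist x y" for x y
  proof -
    have "\<bar>max 0 (r - dist a x) - max 0 (r - dist a y)\<bar> \<le> dist x y"
      using dist_triangle[of a x y] dist_triangle[of a y x] by (auto simp: dist_commute)
    then have "m * \<bar>max 0 (r - dist a x) - max 0 (r - dist a y)\<bar> \<le> m * dist x y"
      using m by (intro mult_left_mono) auto
    then show ?thesis using m by (simp add: g_def abs_mult flip: right_diff_distrib)
  qed
  then obtain e where e: "e \<in> LPM_le m" "apply_bcontfun e = (\<lambda>(x, y). \<bar>g x - g y\<bar>)"
    using LPM_le_witness[OF bd _ pseudometric_abs_diff, of m g] m by auto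
  show ?thesis
    by (rule that[OF e(1)]) (use e g m r in auto)
qed

lemma isometry_betw_UNIV_inv:
  assumes "isometry_betw UNIV UNIV f"
  shows "isometry_betw UNIV UNIV (inv f)" "f (inv f y) = y" "inv f (f x) = x"
proof -
  have f: "surj f" "\<And>x y. dist (f x) (f y) = dist x y"
    using assms by (auto simp: isometry_betw_def)
  then have i: "inj f"
    by (intro injI) (metis dist_eq_0_iff)
  show "f (inv f y) = y" "inv f (f x) = x"
    using f i by (simp_all add: surj_f_inv_f)
  show "isometry_betw UNIV UNIV (inv f)"
    unfolding isometry_betw_def using f i by (metis inj_imp_surj_inv surj_f_inv_f)
qed

section \<open>The isometry between the underlying spaces\<close>

context peak_isometry
begin

text \<open>For \<open>y \<noteq> y'\<close>, \<open>ex_pair\<close> for the inverse supplies a pair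
  with \<open>T e (y, y') = e (z, w)\<close>, which the elements of \<open>LPM_less k\<close>
  determine up to order. This map on pairs comes from a point map \<open>\<phi>\<close>, and
  \<open>ex_pair\<close> for \<open>T\<close> shows that \<open>\<phi>\<close> is onto.\<close>

lemma ex_point_isometry:
  assumes nondegX: "\<exists>x x' :: 'a. x \<noteq> x'" and nondegY: "\<exists>y y' :: 'b. y \<noteq> y'"
  obtains \<phi> :: "'b \<Rightarrow> 'a" where "isometry_betw UNIV UNIV \<phi>"
    "\<And>d x y. d \<in> LPM_less k \<Longrightarrow> apply_bcontfun (T d) (x, y) = apply_bcontfun d (\<phi> x, \<phi> y)"
proof -
  interpret S: peak_isometry k S T by (rule swap)
  define m where "m = k / 2"
  have m: "0 < m" "m < k" using k_pos by (auto simp: m_def)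
  define rel where "rel y y' z w \<longleftrightarrow> z \<noteq> w \<and>
    (\<forall>e\<in>LPM_less k. apply_bcontfun (T e) (y, y') = apply_bcontfun e (z, w))" for y y' z w
  \<comment> \<open>By symmetry of pseudometrics only the unordered pair is determined, so a set is
    chosen.\<close>
  define \<tau> where "\<tau> y y' = (SOME A. \<exists>z w. A = {z, w} \<and> rel y y' z w)" for y y'
  have less: "e \<in> LPM_less k" if "e \<in> LPM_le m" for e :: "('c::metric_space \<times> 'c) \<Rightarrow>\<^sub>C real"
    using LPM_less_iff[OF k_pos] that m by blast
  have sepX: "{x, y} = {z, w}" if "z \<noteq> w"
    "\<And>e. e \<in> LPM_less k \<Longrightarrow> apply_bcontfun e (x, y) = apply_bcontfun e (z, w)" for x y z w :: 'a
    using LPM_le_separates_pairs[OF bounded_dom m(1) that(1)] that(2) less by blast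
  have sepY: "{x, y} = {z, w}" if "z \<noteq> w"
    "\<And>e. e \<in> LPM_less k \<Longrightarrow> apply_bcontfun e (x, y) = apply_bcontfun e (z, w)" for x y z w :: 'b
    using LPM_le_separates_pairs[OF bounded_cod m(1) that(1)] that(2) less by blast
  have e_sym: "apply_bcontfun e (x, y) = apply_bcontfun e (y, x)" if "e \<in> LPM_less k"
    for e :: "('c::metric_space \<times> 'c) \<Rightarrow>\<^sub>C real" and x y
    using that LPM_less_subset LPM_leD(3) by blast
  have rel_ex: "\<exists>z w. rel y y' z w" if yy: "y \<noteq> y'" for y y'
  proof -
    obtain z w where "z \<noteq> w"
      "\<And>e. e \<in> LPM_less k \<Longrightarrow> apply_bcontfun (S e) (z, w) = apply_bcontfun e (y, y')"
      using S.ex_pair[OF yy] by blast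
    then have "rel y y' z w"
      unfolding rel_def using T_mem ST by metis
    then show ?thesis by blast
  qed
  have \<tau>_ex: "\<exists>z w. \<tau> y y' = {z, w} \<and> rel y y' z w" if "y \<noteq> y'" for y y'
    unfolding \<tau>_def by (rule someI_ex) (use rel_ex[OF that] in blast)
  have \<tau>_eq: "\<tau> y y' = {z, w}" if "y \<noteq> y'" "rel y y' z w" for y y' z w
  proof -
    obtain z' w' where "\<tau> y y' = {z', w'}" "rel y y' z' w'" using \<tau>_ex[OF \<open>y \<noteq> y'\<close>] by blast
    then show ?thesis using sepX[of z w z' w'] that by (simp add: rel_def)
  qed
  have \<tau>_val: "apply_bcontfun (T e) (y, y') = apply_bcontfun e (z, w)"
    if "y \<noteq> y'" "\<tau> y y' = {z, w}" "e \<in> LPM_less k" for y y' z w e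
  proof -
    obtain z' w' where "\<tau> y y' = {z', w'}" "rel y y' z' w'" using \<tau>_ex[OF \<open>y \<noteq> y'\<close>] by blast
    then show ?thesis
      using that e_sym[of e z w] by (auto simp: rel_def doubleton_eq_iff)
  qed
  have "\<exists>\<phi>. \<forall>y u. y \<noteq> u \<longrightarrow> \<tau> y u = {\<phi> y, \<phi> u}"
  proof (rule ex_point_map_of_pair_map[OF nondegY])
    fix y u :: 'b assume yu: "y \<noteq> u"
    then obtain z w where zw: "\<tau> y u = {z, w}" "rel y u z w" using \<tau>_ex by blast
    then show "card (\<tau> y u) = 2" by (simp add: rel_def)
    have "rel u y z w"
      using zw(2) e_sym[OF T_mem, of _ u y] by (simp add: rel_def)
    then show "\<tau> y u = \<tau> u y" using zw \<tau>_eq yu by metis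
  next
    fix y u y' u' :: 'b assume d: "y \<noteq> u" "y' \<noteq> u'" and eq: "\<tau> y u = \<tau> y' u'"
    obtain z w where zw: "\<tau> y u = {z, w}" "\<tau> y' u' = {z, w}" using \<tau>_ex[OF d(1)] eq by blast
    show "{y, u} = {y', u'}"
    proof (rule sepY[OF d(2)])
      fix e :: "('b \<times> 'b) \<Rightarrow>\<^sub>C real" assume e: "e \<in> LPM_less k"
      show "apply_bcontfun e (y, u) = apply_bcontfun e (y', u')"
        using \<tau>_val[OF d(1) zw(1) S_mem[OF e]] \<tau>_val[OF d(2) zw(2) S_mem[OF e]] TS[OF e] by simp
    qed
  next
    fix y u v :: 'b assume d: "y \<noteq> u" "y \<noteq> v" "u \<noteq> v"
    obtain z1 w1 where 1: "\<tau> y u = {z1, w1}" "z1 \<noteq> w1"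
      using \<tau>_ex[OF d(1)] by (auto simp: rel_def)
    obtain z2 w2 where 2: "\<tau> y v = {z2, w2}" using \<tau>_ex[OF d(2)] by blast
    obtain z3 w3 where 3: "\<tau> u v = {z3, w3}" using \<tau>_ex[OF d(3)] by blast
    show "\<tau> y u \<subseteq> \<tau> y v \<union> \<tau> u v"
    proof
      fix a assume a: "a \<in> \<tau> y u"
      then obtain b where b: "\<tau> y u = {a, b}" "a \<noteq> b" using 1 by auto
      show "a \<in> \<tau> y v \<union> \<tau> u v"
      proof (rule ccontr)
        assume na: "a \<notin> \<tau> y v \<union> \<tau> u v"
        have fin: "finite (\<tau> y v \<union> \<tau> u v)" using 2 3 by simp
        \<comment> \<open>\<open>e\<close> vanishes on the pairs \<open>\<tau> y v\<close> and
          \<open>\<tau> u v\<close> but not on \<open>\<tau> y u\<close>, which contradicts the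
          triangle inequality of \<open>T e\<close>.\<close>
        obtain e where e: "e \<in> LPM_le m" "0 < apply_bcontfun e (a, b)"
          "\<And>s t. s \<in> \<tau> y v \<union> \<tau> u v \<Longrightarrow> t \<in> \<tau> y v \<union> \<tau> u v \<Longrightarrow> apply_bcontfun e (s, t) = 0"
          using LPM_le_separates_point[OF bounded_dom m(1) fin na b(2)] by metis
        have ek: "e \<in> LPM_less k" using less e by blast
        have "T e \<in> LPM_le k" using T_mem[OF ek] LPM_less_subset by blast
        then have "apply_bcontfun (T e) (y, u) \<le> apply_bcontfun (T e) (y, v) + apply_bcontfun (T e) (u, v)"
          using LPM_leD(3,4) by metis
        then show False
          using \<tau>_val[OF d(1) b(1) ek] \<tau>_val[OF d(2) 2 ek] \<tau>_val[OF d(3) 3 ek] e 2 3 by simp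
      qed
    qed
  qed
  then obtain \<phi> where \<phi>: "\<And>y u. y \<noteq> u \<Longrightarrow> \<tau> y u = {\<phi> y, \<phi> u}" by blast
  have val: "apply_bcontfun (T d) (x, y) = apply_bcontfun d (\<phi> x, \<phi> y)" if d: "d \<in> LPM_less k" for d x y
  proof (cases "x = y")
    case True
    have "d \<in> LPM_le k" "T d \<in> LPM_le k" using d T_mem[OF d] LPM_less_subset by blast+
    then show ?thesis using LPM_leD(2) True by metis
  next
    case False
    then show ?thesis using \<tau>_val \<phi> d by blast
  qed
  have "x \<in> range \<phi>" for x
  proof -
    obtain w where w: "x \<noteq> w" using nondegX by metis
    obtain y y' where y: "y \<noteq> y'"
      "\<And>e. e \<in> LPM_less k \<Longrightarrow> apply_bcontfun (T e) (y, y') = apply_bcontfun e (x, w)"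
      using ex_pair[OF w] by blast
    then have "\<tau> y y' = {x, w}" using \<tau>_eq w by (simp add: rel_def)
    then show ?thesis using \<phi>[OF y(1)] by (auto simp: doubleton_eq_iff)
  qed
  moreover have "dist (\<phi> x) (\<phi> y) = dist x y" for x y
  proof -
    \<comment> \<open>The test pseudometric is \<open>m'\<close> times the metric; its image under
      \<open>T\<close> or \<open>S\<close> satisfies the Lipschitz bound \<open>k\<close>. Letting
      \<open>m'\<close> tend to \<open>k\<close>, as done in \<open>lim\<close>, compares the
      distances.\<close>
    have le: "m' * dist (\<phi> x) (\<phi> y) \<le> k * dist x y \<and> m' * dist x y \<le> k * dist (\<phi> x) (\<phi> y)"
      if m': "0 < m'" "m' < k" for m'
    proof
      obtain e :: "('a \<times> 'a) \<Rightarrow>\<^sub>C real" where e: "e \<in> LPM_le m'"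
        "apply_bcontfun e = (\<lambda>p. m' * (\<lambda>(x, y). dist x y) p)"
        using LPM_le_witness[OF bounded_dom _ pseudometric_scale[OF pseudometric_dist], of m' m'] m'
        by auto
      then have ek: "e \<in> LPM_less k" using LPM_less_iff[OF k_pos] m' by blast
      then have "T e \<in> LPM_le k" using T_mem LPM_less_subset by blast
      then show "m' * dist (\<phi> x) (\<phi> y) \<le> k * dist x y"
        using LPM_leD(5)[of "T e" k x y] val[OF ek, of x y] e by simp
      obtain e :: "('b \<times> 'b) \<Rightarrow>\<^sub>C real" where e: "e \<in> LPM_le m'"
        "apply_bcontfun e = (\<lambda>p. m' * (\<lambda>(x, y). dist x y) p)"
        using LPM_le_witness[OF bounded_cod _ pseudometric_scale[OF pseudometric_dist], of m' m'] m'
        by auto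
      then have ek: "e \<in> LPM_less k" using LPM_less_iff[OF k_pos] m' by blast
      then have "S e \<in> LPM_le k" using S_mem LPM_less_subset by blast
      then show "m' * dist x y \<le> k * dist (\<phi> x) (\<phi> y)"
        using LPM_leD(5)[of "S e" k "\<phi> x" "\<phi> y"] val[OF S_mem[OF ek], of x y] TS[OF ek] e by simp
    qed
    have lim: "k * a \<le> k * b" if "\<And>m'. 0 < m' \<Longrightarrow> m' < k \<Longrightarrow> m' * a \<le> k * b" "0 \<le> a" for a b :: real
    proof (cases "a = 0")
      case True
      then show ?thesis using that(1)[of m] m by simp
    next
      case False
      then have a: "0 < a" using that by simp
      have "k \<le> k * b / a"
      proof (rule dense_le_bounded[of 0])
        show "m' \<le> k * b / a" if "0 < m'" "m' < k" for m'
          using \<open>\<And>m'. 0 < m' \<Longrightarrow> m' < k \<Longrightarrow> m' * a \<le> k * b\<close>[OF that] a by (simp add: pos_le_divide_eq)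
      qed (rule k_pos)
      then show ?thesis using a by (simp add: pos_le_divide_eq)
    qed
    have "k * dist (\<phi> x) (\<phi> y) = k * dist x y"
      using lim[of "dist (\<phi> x) (\<phi> y)" "dist x y"] lim[of "dist x y" "dist (\<phi> x) (\<phi> y)"] le
      by (intro order_antisym) auto
    then show ?thesis using k_pos by simp
  qed
  ultimately have "isometry_betw UNIV UNIV \<phi>"
    by (auto simp: isometry_betw_def)
  then show ?thesis using that val by blast
qed

end

section \<open>Pulling back along isometries\<close>

text \<open>\<open>Bcontfun\<close> has a meaningful value only at bounded continuous functions;
  \<open>apply_pull\<close> verifies this when \<open>\<phi>\<close> is an isometry.\<close>

definition pull ::
  "('b \<Rightarrow> 'a) \<Rightarrow> (('a::metric_space \<times> 'a) \<Rightarrow>\<^sub>C real) \<Rightarrow> (('b::metric_space \<times> 'b) \<Rightarrow>\<^sub>C real)" where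
  "pull \<phi> d = Bcontfun (\<lambda>(x, y). apply_bcontfun d (\<phi> x, \<phi> y))"

lemma isometry_betw_UNIV_continuous:
  assumes "isometry_betw UNIV UNIV \<phi>"
  shows "continuous_on A \<phi>"
proof (rule continuous_onI)
  fix x e assume "0 < (e :: real)"
  then show "\<exists>d>0. \<forall>x'\<in>A. dist x' x < d \<longrightarrow> dist (\<phi> x') (\<phi> x) \<le> e"
    using assms by (intro exI[of _ e]) (simp add: isometry_betw_def)
qed

lemma apply_pull:
  assumes "isometry_betw UNIV UNIV \<phi>"
  shows "apply_bcontfun (pull \<phi> d) (x, y) = apply_bcontfun d (\<phi> x, \<phi> y)"
proof -
  note cont = isometry_betw_UNIV_continuous[OF assms, of UNIV]
  have "continuous_on UNIV (\<lambda>p. (\<phi> (fst p), \<phi> (snd p)))"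
    by (rule continuous_on_Pair[OF
          continuous_on_compose2[OF cont continuous_on_fst[OF continuous_on_id]]
          continuous_on_compose2[OF cont continuous_on_snd[OF continuous_on_id]]]) simp_all
  then have "continuous_on UNIV (\<lambda>p. apply_bcontfun d (\<phi> (fst p), \<phi> (snd p)))"
    by (rule continuous_on_compose2[of UNIV "apply_bcontfun d", rotated]) auto
  moreover have "bounded (range (\<lambda>p. apply_bcontfun d (\<phi> (fst p), \<phi> (snd p))))"
    using bounded_apply_bcontfun[of d] by (rule bounded_subset) auto
  ultimately have "(\<lambda>(x, y). apply_bcontfun d (\<phi> x, \<phi> y)) \<in> bcontfun"
    by (simp add: bcontfun_def case_prod_beta)
  then show ?thesis by (simp add: pull_def Bcontfun_inverse)
qed

lemma pull_inv:
  assumes "isometry_betw UNIV UNIV \<phi>"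
  shows "pull (inv \<phi>) (pull \<phi> d) = d" "pull \<phi> (pull (inv \<phi>) e) = e"
  using isometry_betw_UNIV_inv[OF assms]
  by (auto intro!: bcontfun_eqI simp: apply_pull assms)

text \<open>Each value of a pullback is a value of the original at the image pair, so distances
  cannot grow; the same for \<open>inv \<phi>\<close> gives equality.\<close>

lemma dist_pull:
  assumes "isometry_betw UNIV UNIV \<phi>"
  shows "dist (pull \<phi> d) (pull \<phi> e) = dist d e"
proof -
  have le: "dist (pull \<psi> d) (pull \<psi> e) \<le> dist d e" if "isometry_betw UNIV UNIV \<psi>"
    for d e and \<psi> :: "'c::metric_space \<Rightarrow> 'd::metric_space"
    using dist_bounded[of d _ e] by (intro dist_bound) (auto simp: apply_pull that)
  show ?thesis
    using le[OF assms, of d e] le[OF isometry_betw_UNIV_inv(1)[OF assms], of "pull \<phi> d" "pull \<phi> e"]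
    by (simp add: pull_inv assms)
qed

lemma norm_pull:
  assumes "isometry_betw UNIV UNIV \<phi>"
  shows "norm (pull \<phi> d) = norm d"
proof -
  have "pull \<phi> 0 = 0"
    by (auto intro!: bcontfun_eqI simp: apply_pull assms zero_bcontfun.rep_eq)
  then show ?thesis using dist_pull[OF assms, of d 0] by simp
qed

lemma pull_pseudometric:
  assumes "isometry_betw UNIV UNIV \<phi>" "pseudometric (apply_bcontfun d)"
  shows "pseudometric (apply_bcontfun (pull \<phi> d))"
  unfolding pseudometric_def apply_pull[OF assms(1)] using pseudometricD[OF assms(2)] by blast

lemma pull_LPM_le:
  assumes "isometry_betw UNIV UNIV \<phi>" "d \<in> LPM_le m"
  shows "pull \<phi> d \<in> LPM_le m"
proof -
  have "apply_bcontfun (pull \<phi> d) (x, y) \<le> m * dist x y" for x y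
    using LPM_leD(5)[OF assms(2), of "\<phi> x" "\<phi> y"] assms(1)
    by (simp add: apply_pull isometry_betw_def)
  then show ?thesis
    using pull_pseudometric[OF assms(1)] LPM_leD(6)[OF assms(2)] by (simp add: LPM_le_iff)
qed

lemma pull_LPM_less:
  assumes "isometry_betw UNIV UNIV \<phi>" "0 < k" "d \<in> LPM_less k"
  shows "pull \<phi> d \<in> LPM_less k"
  using assms(3) pull_LPM_le[OF assms(1)] unfolding LPM_less_iff[OF assms(2)] by blast

lemma pull_Pp:
  assumes iso: "isometry_betw UNIV UNIV \<phi>" and d: "d \<in> Pp"
  shows "pull \<phi> d \<in> Pp"
proof -
  note inv = isometry_betw_UNIV_inv[OF iso]
  obtain z w where zw: "apply_bcontfun d (z, w) = norm d"
    "\<And>x y. apply_bcontfun d (x, y) = norm d \<Longrightarrow> {x, y} = {z, w}"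
    using PpE[OF d] by metis
  show ?thesis
  proof (rule PpI)
    show "pull \<phi> d \<in> PM" using d pull_pseudometric[OF iso] by (simp add: Pp_def PM_def)
    show "apply_bcontfun (pull \<phi> d) (inv \<phi> z, inv \<phi> w) = norm (pull \<phi> d)"
      using zw(1) inv(2) by (simp add: apply_pull norm_pull iso)
    fix x y assume "apply_bcontfun (pull \<phi> d) (x, y) = norm (pull \<phi> d)"
    then have "{\<phi> x, \<phi> y} = {z, w}"
      using zw(2) by (simp add: apply_pull norm_pull iso)
    then have "inv \<phi> ` {\<phi> x, \<phi> y} = inv \<phi> ` {z, w}" by simp
    then show "{x, y} = {inv \<phi> z, inv \<phi> w}" by (simp add: inv(3))
  qed
qed

lemma pull_Pc:
  assumes iso: "isometry_betw UNIV UNIV \<phi>" and d: "d \<in> Pc"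
  shows "pull \<phi> d \<in> Pc"
proof -
  note inv = isometry_betw_UNIV_inv[OF iso]
  obtain z w K where zw: "z \<noteq> w" "compact K" "apply_bcontfun d (z, w) = norm d"
    "\<And>x y. apply_bcontfun d (x, y) = norm d \<Longrightarrow> x \<in> K \<and> y \<in> K"
    using d by (auto simp: Pc_def)
  have "pull \<phi> d \<in> PM" using d pull_pseudometric[OF iso] by (simp add: Pc_def PM_def)
  moreover have "inv \<phi> z \<noteq> inv \<phi> w" using zw(1) inv(2) by metis
  moreover have "compact (inv \<phi> ` K)"
    using zw(2) isometry_betw_UNIV_continuous[OF inv(1)] by (rule compact_continuous_image[rotated])
  moreover have "x \<in> inv \<phi> ` K \<and> y \<in> inv \<phi> ` K"
    if "apply_bcontfun (pull \<phi> d) (x, y) = norm (pull \<phi> d)" for x y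
  proof -
    have "\<phi> x \<in> K" "\<phi> y \<in> K"
      using zw(4) that by (simp_all add: apply_pull norm_pull iso)
    then show ?thesis using inv(3) by (metis imageI)
  qed
  moreover have "apply_bcontfun (pull \<phi> d) (inv \<phi> z, inv \<phi> w) = norm (pull \<phi> d)"
    using zw(3) inv(2) by (simp add: apply_pull norm_pull iso)
  ultimately show ?thesis unfolding Pc_def by blast
qed

lemma pull_image:
  assumes "isometry_betw UNIV UNIV \<phi>"
    and "\<And>d. d \<in> A \<Longrightarrow> pull \<phi> d \<in> B" "\<And>e. e \<in> B \<Longrightarrow> pull (inv \<phi>) e \<in> A"
  shows "pull \<phi> ` A = B"
  using assms pull_inv(2)[OF assms(1)] by (metis image_iff subsetI image_subsetI subset_antisym)

text \<open>A nonzero element of \<open>Pp\<close> lies in \<open>PX\<close> for either choice, so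
  \<open>T\<close> sends it into \<open>PY\<close>, whose elements all attain their norm. The
  inverse is treated alike.\<close>

lemma peak_isometry_of_isometry:
  fixes T :: "(('a::metric_space \<times> 'a) \<Rightarrow>\<^sub>C real) \<Rightarrow> (('b::metric_space \<times> 'b) \<Rightarrow>\<^sub>C real)"
  assumes k: "0 < k" and bd: "bounded (UNIV :: 'a set)" "bounded (UNIV :: 'b set)"
    and P: "PX = Pc \<and> PY = Pc \<or> PX = Pp \<and> PY = Pp"
    and iso: "isometry_betw (LPM_less k) (LPM_less k) T"
    and TP: "T ` (PX \<inter> LPM_less k) = PY \<inter> LPM_less k"
  shows "peak_isometry k T (inv_into (LPM_less k) T)"
proof -
  have im: "T ` LPM_less k = LPM_less k"
    and d: "\<And>d e. d \<in> LPM_less k \<Longrightarrow> e \<in> LPM_less k \<Longrightarrow> dist (T d) (T e) = dist d e"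
    using iso by (auto simp: isometry_betw_def)
  have inj: "inj_on T (LPM_less k)"
    by (intro inj_onI) (metis d dist_eq_0_iff)
  have PX: "d \<in> PX" if "d \<in> Pp" "d \<noteq> 0" for d using P that Pp_subset_Pc by blast
  have PY: "e \<in> PY" if "e \<in> Pp" "e \<noteq> 0" for e using P that Pp_subset_Pc by blast
  have att: "\<exists>z w. apply_bcontfun d (z, w) = norm d" if "d \<in> Pp \<or> d \<in> Pc"
    for d :: "('c::metric_space \<times> 'c) \<Rightarrow>\<^sub>C real"
    using that by (elim disjE PpE) (auto simp: Pc_def)
  have attX: "\<exists>z w. apply_bcontfun d (z, w) = norm d" if "d \<in> PX" for d
    using P that att by blast
  have attY: "\<exists>z w. apply_bcontfun e (z, w) = norm e" if "e \<in> PY" for e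
    using P that att by blast
  show ?thesis
  proof
    fix e :: "('b \<times> 'b) \<Rightarrow>\<^sub>C real"
    assume e: "e \<in> LPM_less k" "e \<in> Pp" "e \<noteq> 0"
    then obtain d where "d \<in> PX \<inter> LPM_less k" "e = T d" using PY TP by blast
    then show "\<exists>z w. apply_bcontfun (inv_into (LPM_less k) T e) (z, w) =
        norm (inv_into (LPM_less k) T e)"
      using attX inj by simp
  next
    fix d :: "('a \<times> 'a) \<Rightarrow>\<^sub>C real"
    assume "d \<in> LPM_less k" "d \<in> Pp" "d \<noteq> 0"
    then have "T d \<in> PY" using PX TP by blast
    then show "\<exists>y y'. apply_bcontfun (T d) (y, y') = norm (T d)" using attY by blast
  next
    fix d :: "('a \<times> 'a) \<Rightarrow>\<^sub>C real" assume "d \<in> LPM_less k"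
    then show "T d \<in> LPM_less k" "inv_into (LPM_less k) T (T d) = d"
      using im inj by auto
  next
    fix e :: "('b \<times> 'b) \<Rightarrow>\<^sub>C real" assume "e \<in> LPM_less k"
    then show "inv_into (LPM_less k) T e \<in> LPM_less k" "T (inv_into (LPM_less k) T e) = e"
      using im by (simp_all add: inv_into_into f_inv_into_f)
  qed (use k bd d in auto)
qed

text \<open>\<open>T\<close> and \<open>pull \<phi>\<close> both preserve distances, and
  \<open>LPM_less k\<close> is dense in \<open>LPM_le k\<close>: multiples of \<open>d\<close> by
  positive factors below \<open>1\<close> approach \<open>d\<close>.\<close>

lemma pull_formula_extends:
  assumes k: "0 < k" and \<phi>: "isometry_betw UNIV UNIV \<phi>"
    and T: "\<And>d e. d \<in> LPM_le k \<Longrightarrow> e \<in> LPM_le k \<Longrightarrow> dist (T d) (T e) = dist d e"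
    and eq: "\<And>d. d \<in> LPM_less k \<Longrightarrow> T d = pull \<phi> d"
    and d: "d \<in> LPM_le k"
  shows "T d = pull \<phi> d"
proof -
  \<comment> \<open>The double successor keeps \<open>c 0 = 1 / 2\<close> positive.\<close>
  define c where "c n = 1 - inverse (real (Suc (Suc n)))" for n
  define u where "u n = c n *\<^sub>R d" for n
  have c: "0 < c n" "c n < 1" for n
    by (simp_all add: c_def field_simps)
  have "c \<longlonglongrightarrow> 1 - 0"
    unfolding c_def by (intro tendsto_diff tendsto_const LIMSEQ_Suc[OF LIMSEQ_inverse_real_of_nat])
  then have "(\<lambda>n. c n *\<^sub>R d) \<longlonglongrightarrow> 1 *\<^sub>R d"
    by (intro tendsto_scaleR tendsto_const) simp
  then have u: "u \<longlonglongrightarrow> d"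
    by (simp add: u_def[abs_def])
  have uk: "u n \<in> LPM_less k" for n
  proof -
    have "u n \<in> LPM_le (c n * k)"
      unfolding u_def by (rule scaleR_LPM_le[OF d less_imp_le[OF c(1)]])
    moreover have "0 < c n * k" "c n * k < k"
      using k c[of n] by simp_all
    ultimately show ?thesis using LPM_less_iff[OF k] by blast
  qed
  have lim: "(\<lambda>n. dist (u n) d) \<longlonglongrightarrow> 0"
    using u by (rule tendsto_dist_iff[THEN iffD1])
  have "dist (T (u n)) (T d) = dist (u n) d" for n
    using T[OF subsetD[OF LPM_less_subset uk] d] .
  then have 1: "(\<lambda>n. T (u n)) \<longlonglongrightarrow> T d"
    using lim by (subst tendsto_dist_iff) simp
  have "dist (T (u n)) (pull \<phi> d) = dist (u n) d" for n
    using dist_pull[OF \<phi>] eq[OF uk] by simp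
  then have "(\<lambda>n. T (u n)) \<longlonglongrightarrow> pull \<phi> d"
    using lim by (subst tendsto_dist_iff) simp
  with 1 show ?thesis by (rule LIMSEQ_unique)
qed

text \<open>Peaks show that \<open>\<phi>\<close> and \<open>\<psi>\<close> agree on unordered
  pairs. With three points, \<open>\<phi> x\<close> lies in two pairs that share only
  \<open>\<psi> x\<close>.\<close>

lemma point_isometry_unique:
  fixes \<phi> \<psi> :: "'b::metric_space \<Rightarrow> 'a::metric_space"
  assumes bd: "bounded (UNIV :: 'a set)" and k: "0 < k"
    and iso: "isometry_betw UNIV UNIV \<phi>" "isometry_betw UNIV UNIV \<psi>"
    and eq: "\<And>d x y. d \<in> LPM_le k \<Longrightarrow>
      apply_bcontfun d (\<phi> x, \<phi> y) = apply_bcontfun d (\<psi> x, \<psi> y)"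
    and third: "\<And>x y :: 'b. \<exists>v. v \<noteq> x \<and> v \<noteq> y"
  shows "\<phi> = \<psi>"
proof
  fix x :: 'b
  have inj: "\<psi> u \<noteq> \<psi> v" if "u \<noteq> v" for u v
    using iso(2) that by (metis UNIV_I dist_eq_0_iff isometry_betw_def)
  have pair: "{\<phi> u, \<phi> v} = {\<psi> u, \<psi> v}" if "u \<noteq> v" for u v
    by (rule LPM_le_separates_pairs[OF bd k inj[OF that] eq])
  obtain y where y: "y \<noteq> x" using third by metis
  obtain v where v: "v \<noteq> x" "v \<noteq> y" using third by metis
  have "\<phi> x \<in> {\<psi> x, \<psi> y}" "\<phi> x \<in> {\<psi> x, \<psi> v}"
    using pair[OF y[symmetric]] pair[OF v(1)[symmetric]] by blast+
  then show "\<phi> x = \<psi> x"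
    using inj[OF v(2)] by auto
qed

section \<open>Equivalence of the three conditions and uniqueness of the point isometry\<close>

lemma CARD_eq_2I:
  fixes x y :: 'b
  assumes "x \<noteq> y" "\<And>v. v = x \<or> v = y"
  shows "CARD('b) = 2"
proof -
  have "(UNIV :: 'b set) = {x, y}" using assms(2) by blast
  moreover have "card {x, y} = 2" using assms(1) by simp
  ultimately show ?thesis by (rule ssubst)
qed

theorem theoremC:
  fixes k :: real
    and PX :: "(('a::metric_space \<times> 'a) \<Rightarrow>\<^sub>C real) set"
    and PY :: "(('b::metric_space \<times> 'b) \<Rightarrow>\<^sub>C real) set"
  assumes "\<exists>x y :: 'a. x \<noteq> y" and "\<exists>x y :: 'b. x \<noteq> y"
    and "bounded (UNIV :: 'a set)" and "bounded (UNIV :: 'b set)"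
    and "k > 0"
    and "PX = Pc \<and> PY = Pc \<or> PX = Pp \<and> PY = Pp"
  shows
    "((\<exists>f :: 'a \<Rightarrow> 'b. isometry_betw UNIV UNIV f) \<longleftrightarrow>
        (\<exists>T. isometry_betw (LPM_le k) (LPM_le k) T \<and>
             T ` LPM_less k = LPM_less k \<and>
             T ` (PX \<inter> LPM_less k) = PY \<inter> LPM_less k)) \<and>
     ((\<exists>f :: 'a \<Rightarrow> 'b. isometry_betw UNIV UNIV f) \<longleftrightarrow>
        (\<exists>T. isometry_betw (LPM_less k) (LPM_less k) T \<and>
             T ` (PX \<inter> LPM_less k) = PY \<inter> LPM_less k)) \<and>
     (\<forall>T. isometry_betw (LPM_le k) (LPM_le k) T \<and>
          T ` LPM_less k = LPM_less k \<and>
          T ` (PX \<inter> LPM_less k) = PY \<inter> LPM_less k \<longrightarrow>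
        (\<exists>\<phi> :: 'b \<Rightarrow> 'a. isometry_betw UNIV UNIV \<phi> \<and>
           (\<forall>d\<in>LPM_le k. \<forall>x y. apply_bcontfun (T d) (x, y) = apply_bcontfun d (\<phi> x, \<phi> y))) \<and>
        (\<not> (CARD('a) = 2 \<or> CARD('b) = 2) \<longrightarrow>
          (\<exists>!\<phi> :: 'b \<Rightarrow> 'a. isometry_betw UNIV UNIV \<phi> \<and>
             (\<forall>d\<in>LPM_le k. \<forall>x y. apply_bcontfun (T d) (x, y) = apply_bcontfun d (\<phi> x, \<phi> y)))))"
    (is "(?I \<longleftrightarrow> (\<exists>T. ?L T)) \<and> (?I \<longleftrightarrow> (\<exists>T. ?M T)) \<and> ?R")
proof -
  note nondeg = assms(1,2) and bd = assms(3,4) and k = assms(5) and P = assms(6)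
  \<comment> \<open>Condition (2) implies (3) by restricting \<open>T\<close> to
    \<open>LPM_less k\<close>.\<close>
  have LM: "?M T" if "?L T" for T :: "(('a \<times> 'a) \<Rightarrow>\<^sub>C real) \<Rightarrow> (('b \<times> 'b) \<Rightarrow>\<^sub>C real)"
  proof
    have "dist (T d) (T e) = dist d e" if "d \<in> LPM_less k" "e \<in> LPM_less k" for d e
      using \<open>?L T\<close> subsetD[OF LPM_less_subset that(1)] subsetD[OF LPM_less_subset that(2)]
      by (simp add: isometry_betw_def)
    then show "isometry_betw (LPM_less k) (LPM_less k) T"
      using that by (simp add: isometry_betw_def)
  qed (use that in simp)
  have less: "\<exists>\<phi> :: 'b \<Rightarrow> 'a. isometry_betw UNIV UNIV \<phi> \<and> (\<forall>d\<in>LPM_less k. T d = pull \<phi> d)"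
    if T: "?M T" for T
  proof -
    interpret peak_isometry k T "inv_into (LPM_less k) T"
      by (rule peak_isometry_of_isometry[OF k bd P conjunct1[OF T] conjunct2[OF T]])
    obtain \<phi> :: "'b \<Rightarrow> 'a" where "isometry_betw UNIV UNIV \<phi>"
      "\<And>d x y. d \<in> LPM_less k \<Longrightarrow> apply_bcontfun (T d) (x, y) = apply_bcontfun d (\<phi> x, \<phi> y)"
      using ex_point_isometry[OF nondeg] by blast
    note \<phi> = this
    have "T d = pull \<phi> d" if "d \<in> LPM_less k" for d
      using \<phi>(2)[OF that] by (intro bcontfun_eqI) (auto simp: apply_pull[OF \<phi>(1)])
    then show ?thesis using \<phi>(1) by (intro exI[of _ \<phi>] conjI ballI)
  qed
  have MI: "?I" if T: "?M T" for T :: "(('a \<times> 'a) \<Rightarrow>\<^sub>C real) \<Rightarrow> (('b \<times> 'b) \<Rightarrow>\<^sub>C real)"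
  proof -
    obtain \<phi> :: "'b \<Rightarrow> 'a" where "isometry_betw UNIV UNIV \<phi>"
      using less[OF T] by (elim exE conjE)
    then show ?I
      by (intro exI[of _ "inv \<phi>"] isometry_betw_UNIV_inv(1))
  qed
  \<comment> \<open>Pulling back along the inverse of \<open>f\<close> carries pseudometrics on the
    first space to the second and preserves every class involved.\<close>
  have IL: "\<exists>T. ?L T" if I: ?I
  proof -
    obtain f :: "'a \<Rightarrow> 'b" where f: "isometry_betw UNIV UNIV f" using I by blast
    note g = isometry_betw_UNIV_inv(1)[OF f]
    note g' = isometry_betw_UNIV_inv(1)[OF g]
    have "pull (inv f) ` LPM_le k = LPM_le k"
      by (rule pull_image[OF g pull_LPM_le[OF g] pull_LPM_le[OF g']])
    moreover have "pull (inv f) ` LPM_less k = LPM_less k"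
      by (rule pull_image[OF g pull_LPM_less[OF g k] pull_LPM_less[OF g' k]])
    moreover have "pull (inv f) ` (PX \<inter> LPM_less k) = PY \<inter> LPM_less k"
    proof (rule pull_image[OF g])
      show "pull (inv f) d \<in> PY \<inter> LPM_less k" if "d \<in> PX \<inter> LPM_less k" for d
        using P that pull_LPM_less[OF g k] pull_Pc[OF g] pull_Pp[OF g] by blast
      show "pull (inv (inv f)) e \<in> PX \<inter> LPM_less k" if "e \<in> PY \<inter> LPM_less k" for e
        using P that pull_LPM_less[OF g' k] pull_Pc[OF g'] pull_Pp[OF g'] by blast
    qed
    ultimately show ?thesis
      by (intro exI[of _ "pull (inv f)"]) (simp add: isometry_betw_def dist_pull[OF g])
  qed
  have R: ?R
  proof (intro allI impI, elim conjE)
    fix T :: "(('a \<times> 'a) \<Rightarrow>\<^sub>C real) \<Rightarrow> (('b \<times> 'b) \<Rightarrow>\<^sub>C real)"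
    assume "isometry_betw (LPM_le k) (LPM_le k) T" "T ` LPM_less k = LPM_less k"
      "T ` (PX \<inter> LPM_less k) = PY \<inter> LPM_less k"
    then have T: "?L T" by blast
    obtain \<phi> :: "'b \<Rightarrow> 'a" where \<phi>: "isometry_betw UNIV UNIV \<phi>"
      "\<And>d. d \<in> LPM_less k \<Longrightarrow> T d = pull \<phi> d"
      using less[OF LM[OF T]] by blast
    have "T d = pull \<phi> d" if "d \<in> LPM_le k" for d
    proof (rule pull_formula_extends[OF k \<phi>(1) _ \<phi>(2) that])
      show "dist (T d) (T e) = dist d e" if "d \<in> LPM_le k" "e \<in> LPM_le k" for d e
        using T that by (simp add: isometry_betw_def)
    qed
    then have val: "\<forall>d\<in>LPM_le k. \<forall>x y.
        apply_bcontfun (T d) (x, y) = apply_bcontfun d (\<phi> x, \<phi> y)"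
      by (simp add: apply_pull \<phi>)
    \<comment> \<open>A nondegenerate space whose cardinality is not \<open>2\<close> has a third
      point beside any two. Infinite types are covered, as \<open>CARD\<close> is \<open>0\<close>
      there.\<close>
    have unique: "\<psi> = \<phi>" if card: "CARD('b) \<noteq> 2" and iso: "isometry_betw UNIV UNIV \<psi>"
      and \<psi>: "\<forall>d\<in>LPM_le k. \<forall>x y. apply_bcontfun (T d) (x, y) = apply_bcontfun d (\<psi> x, \<psi> y)" for \<psi>
    proof (rule point_isometry_unique[OF bd(1) k iso \<phi>(1)])
      show "apply_bcontfun d (\<psi> x, \<psi> y) = apply_bcontfun d (\<phi> x, \<phi> y)" if "d \<in> LPM_le k" for d x y
        using bspec[OF val that] bspec[OF \<psi> that] by simp
      show "\<exists>v. v \<noteq> x \<and> v \<noteq> y" for x y :: 'b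
      proof (cases "x = y")
        case True
        then show ?thesis using nondeg(2) by metis
      next
        case False
        then show ?thesis using CARD_eq_2I[OF False] card by blast
      qed
    qed
    show "(\<exists>\<phi> :: 'b \<Rightarrow> 'a. isometry_betw UNIV UNIV \<phi> \<and>
           (\<forall>d\<in>LPM_le k. \<forall>x y. apply_bcontfun (T d) (x, y) = apply_bcontfun d (\<phi> x, \<phi> y))) \<and>
        (\<not> (CARD('a) = 2 \<or> CARD('b) = 2) \<longrightarrow>
          (\<exists>!\<phi> :: 'b \<Rightarrow> 'a. isometry_betw UNIV UNIV \<phi> \<and>
             (\<forall>d\<in>LPM_le k. \<forall>x y. apply_bcontfun (T d) (x, y) = apply_bcontfun d (\<phi> x, \<phi> y))))"
    proof (intro conjI impI)
      show "\<exists>\<phi> :: 'b \<Rightarrow> 'a. isometry_betw UNIV UNIV \<phi> \<and>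
          (\<forall>d\<in>LPM_le k. \<forall>x y. apply_bcontfun (T d) (x, y) = apply_bcontfun d (\<phi> x, \<phi> y))"
        using \<phi>(1) val by (intro exI[of _ \<phi>] conjI)
      assume "\<not> (CARD('a) = 2 \<or> CARD('b) = 2)"
      then have card: "CARD('b) \<noteq> 2" by simp
      show "\<exists>!\<phi> :: 'b \<Rightarrow> 'a. isometry_betw UNIV UNIV \<phi> \<and>
          (\<forall>d\<in>LPM_le k. \<forall>x y. apply_bcontfun (T d) (x, y) = apply_bcontfun d (\<phi> x, \<phi> y))"
      proof (rule ex1I[of _ \<phi>])
        show "isometry_betw UNIV UNIV \<phi> \<and>
            (\<forall>d\<in>LPM_le k. \<forall>x y. apply_bcontfun (T d) (x, y) = apply_bcontfun d (\<phi> x, \<phi> y))"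
          using \<phi>(1) val by (intro conjI)
      qed (elim conjE, rule unique[OF card])
    qed
  qed
  have "?I \<longleftrightarrow> (\<exists>T. ?L T)"
  proof
    assume "\<exists>T. ?L T"
    then obtain T where T: "?L T" by (rule exE)
    show ?I by (rule MI[OF LM[OF T]])
  qed (rule IL)
  moreover have "?I \<longleftrightarrow> (\<exists>T. ?M T)"
  proof
    assume ?I
    from IL[OF this] obtain T where T: "?L T" by (rule exE)
    show "\<exists>T. ?M T" using LM[OF T] by (rule exI[of _ T])
  next
    assume "\<exists>T. ?M T"
    then obtain T where T: "?M T" by (rule exE)
    show ?I by (rule MI[OF T])
  qed
  ultimately show ?thesis
    using R by (intro conjI)
qed

end
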